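(* Let $m,p$ be positive integers. Any quasitubal tensor $\mathcal{X}\in\mathcal{H}_*^{m\times p}$ admits a quasitubal SVD, that is, a factorization $\mathcal{X}=\mathcal{U}\star_F\mathcal{S}\star_F\mathcal{V}^*$ where $\mathcal{U}\in\mathcal{H}_*^{m\times m}$ and $\mathcal{V}\in\mathcal{H}_*^{p\times p}$ are $\star_F$-unitary and $\mathcal{S}\in\mathcal{H}_*^{m\times p}$ is f-diagonal with diagonal entries satisfying $s_1\geq_{\mathcal{H}_*}s_2\geq_{\mathcal{H}_*}\cdots\geq_{\mathcal{H}_*}s_{\min(m,p)}\geq_{\mathcal{H}_*}0$.
   Context: $\mathbb{F}$ is $\mathbb{R}$ or $\mathbb{C}$. $\mathcal{H}$ is a separable infinite-dimensional Hilbert space over $\mathbb{F}$ (inner product linear in the first argument) with a fixed orthonormal basis $F=\{\phi^{(j)}\}_{j\in\mathbb{Z}}$. For $x\in\mathcal{H}$ put $\widehat{x}_j=\langle x,\phi^{(j)}\rangle_{\mathcal{H}}$, and define $x\star_F y=\sum_{j}\widehat{x}_j\widehat{y}_j\phi^{(j)}\in\mathcal{H}$. A map $T:\mathcal{H}\to\mathcal{H}$ is $\mathcal{H}$-linear if $T(a\star_F x+b\star_F y)=a\star_F T(x)+b\star_F T(y)$ for all $a,b,x,y\in\mathcal{H}$. A quasitube is a bounded $\mathcal{H}$-linear operator on $\mathcal{H}$; $\mathcal{H}_*$ is the set of quasitubes, a commutative unital C*-algebra over $\mathbb{F}$ under composition (also written $\star_F$), Hilbert space adjoint $q\mapsto q^*$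 and operator norm; its unit (the identity operator) is $e$. The map $\pi(q)=(\langle q(\phi^{(j)}),\phi^{(j)}\rangle_{\mathcal{H}})_{j\in\mathbb{Z}}$ is an isometric *-isomorphism of $\mathcal{H}_*$ onto $\ell_\infty(\mathbb{Z})$ (entrywise operations, sup norm). Order: the spectrum of $a\in\mathcal{H}_*$ is the set of $\lambda\in\mathbb{F}$ such that $a-\lambda e$ is not invertible in $\mathcal{H}_*$; $a\geq_{\mathcal{H}_*}0$ means $a=a^*$ and the spectrum of $a$ is contained in $[0,\infty)$; $a\geq_{\mathcal{H}_*}b$ means $a-b\geq_{\mathcal{H}_*}0$. Quasitubal tensors: an $m\times p$ quasitubal tensor is a matrix $\mathcal{X}=(x_{ij})\in\mathcal{H}_*^{m\times p}$. Its $k$-th transformed frontal slice ($k\in\mathbb{Z}$) is the matrix $\widehat{\mathcal{X}}_{:,:,k}\in\mathbb{F}^{m\times p}$ with entries $\pi(x_{ij})_k$. The product $\mathcal{X}\star_F\mathcal{Y}$ is the quasitubal tensor with slices $\widehat{\mathcal{X}}_{:,:,k}\widehat{\mathcal{Y}}_{:,:,k}$ (equivalently, the matrix product over $\mathcal{H}_*$), and $\mathcal{X}^*$ is the quasitubal tensor with slices $(\widehat{\mathcal{X}}_{:,:,k})^{\mathrm{H}}$ (conjugate transpose). The identity tensor $\mathcal{I}$ has $e$ on the diagonal and $0$ elsewhere. $\mathcal{U}\in\mathcal{H}_*^{p\times p}$ is $\star_F$-unitary if $\mathcal{U}^*\star_F\mathcal{U}=\mathcal{U}\star_F\mathcal{U}^*=\mathcal{I}$.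 $\mathcal{S}$ is f-diagonal if every $\widehat{\mathcal{S}}_{:,:,k}$ is a (possibly rectangular) diagonal matrix. *)

theory Defs
  imports
    "HOL-Analysis.Analysis"
    "Jordan_Normal_Form.Matrix"
    "Jordan_Normal_Form.Schur_Decomposition"
begin

text \<open>
  The scalar field is \<open>\<real>\<close> or \<open>\<complex>\<close>. The second axiom says that the field is a copy of \<open>\<real>\<close> or
  of \<open>\<real>(i)\<close> with \<open>i\<^sup>2 = -1\<close>; the first one then forces the conjugation and the norm to be the
  usual ones of \<open>\<real>\<close> or \<open>\<complex>\<close>.
\<close>

class real_or_complex = real_normed_field + conjugatable_field +
  assumes mult_conjugate: "x * conjugate x = (norm x)\<^sup>2 *\<^sub>R 1"
    and real_or_complex:
      "(\<forall>x. \<exists>a. x = a *\<^sub>R 1) \<or>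
       (\<exists>i. i * i = - 1 \<and> (\<forall>x. \<exists>a b. x = a *\<^sub>R 1 + b *\<^sub>R i))"

instance real :: real_or_complex
proof
  fix x :: real
  show "x * conjugate x = (norm x)\<^sup>2 *\<^sub>R 1"
    by (simp add: power2_eq_square)
  show "(\<forall>x::real. \<exists>a. x = a *\<^sub>R 1) \<or>
       (\<exists>i::real. i * i = - 1 \<and> (\<forall>x. \<exists>a b. x = a *\<^sub>R 1 + b *\<^sub>R i))"
    by simp
qed

instance complex :: real_or_complex
proof
  fix x :: complex
  show "x * conjugate x = (norm x)\<^sup>2 *\<^sub>R 1"
    by (simp add: complex_norm_square[symmetric] scaleR_conv_of_real del: of_real_power)
  have "x = Re x *\<^sub>R 1 + Im x *\<^sub>R \<i>" for x
    by (simp add: complex_eq_iff)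
  then show "(\<forall>x::complex. \<exists>a. x = a *\<^sub>R 1) \<or>
       (\<exists>i::complex. i * i = - 1 \<and> (\<forall>x. \<exists>a b. x = a *\<^sub>R 1 + b *\<^sub>R i))"
    using i_squared by blast
qed

text \<open>
  A Hilbert space over \<open>'f\<close> with an orthonormal basis indexed by the integers; in particular it is
  separable and infinite-dimensional. Completeness comes from the class \<open>banach\<close>, whose norm is
  the one induced by the inner product \<open>ip\<close>; below, \<open>span\<close> is the span over \<open>'f\<close>.
\<close>

locale quasitubal = vector_space scale
  for scale :: "'f::real_or_complex \<Rightarrow> 'h::banach \<Rightarrow> 'h" +
  fixes ip :: "'h \<Rightarrow> 'h \<Rightarrow> 'f"
    and \<phi> :: "int \<Rightarrow> 'h"
  assumes scale_of_real: "scale (of_real r) x = r *\<^sub>R x"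
    and ip_add_left: "ip (x + y) z = ip x z + ip y z"
    and ip_scale_left: "ip (scale c x) y = c * ip x y"
    and ip_commute: "ip y x = conjugate (ip x y)"
    and ip_self: "ip x x = of_real ((norm x)\<^sup>2)"
    and orthonormal: "ip (\<phi> i) (\<phi> j) = (if i = j then 1 else 0)"
    and dense_span: "closure (span (range \<phi>)) = UNIV"
begin

definition coef :: "'h \<Rightarrow> int \<Rightarrow> 'f" where
  "coef x j = ip x (\<phi> j)"

definition star :: "'h \<Rightarrow> 'h \<Rightarrow> 'h" where
  "star x y = (\<Sum>\<^sub>\<infinity>j\<in>UNIV. scale (coef x j * coef y j) (\<phi> j))"

definition H_linear :: "('h \<Rightarrow> 'h) \<Rightarrow> bool" where
  "H_linear T \<longleftrightarrow> (\<forall>a b x y. T (star a x + star b y) = star a (T x) + star b (T y))"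

text \<open>\<open>H_linear\<close> already entails linearity over \<open>'f\<close>: take for \<open>a\<close> multiples of basis vectors.\<close>

definition quasitubes :: "('h \<Rightarrow> 'h) set" where
  "quasitubes = {q. H_linear q \<and> (\<exists>K. \<forall>x. norm (q x) \<le> K * norm x)}"

definition pi_map :: "('h \<Rightarrow> 'h) \<Rightarrow> int \<Rightarrow> 'f" where
  "pi_map q j = ip (q (\<phi> j)) (\<phi> j)"

definition hadjoint :: "('h \<Rightarrow> 'h) \<Rightarrow> 'h \<Rightarrow> 'h" where
  "hadjoint q = (THE r. \<forall>x y. ip (q x) y = ip x (r y))"

definition qinvertible :: "('h \<Rightarrow> 'h) \<Rightarrow> bool" where
  "qinvertible q \<longleftrightarrow> (\<exists>r\<in>quasitubes. r \<circ> q = id \<and> q \<circ> r = id)"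

definition qspectrum :: "('h \<Rightarrow> 'h) \<Rightarrow> 'f set" where
  "qspectrum q = {c. \<not> qinvertible (\<lambda>x. q x - scale c x)}"

definition qnonneg :: "('h \<Rightarrow> 'h) \<Rightarrow> bool" where
  "qnonneg q \<longleftrightarrow> q \<in> quasitubes \<and> q = hadjoint q \<and> qspectrum q \<subseteq> of_real ` {0..}"

definition qgeq :: "('h \<Rightarrow> 'h) \<Rightarrow> ('h \<Rightarrow> 'h) \<Rightarrow> bool" where
  "qgeq q r \<longleftrightarrow> qnonneg (\<lambda>x. q x - r x)"

definition tensors :: "nat \<Rightarrow> nat \<Rightarrow> ('h \<Rightarrow> 'h) mat set" where
  "tensors m p = {X \<in> carrier_mat m p. \<forall>i<m. \<forall>j<p. X $$ (i, j) \<in> quasitubes}"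

definition slice :: "('h \<Rightarrow> 'h) mat \<Rightarrow> int \<Rightarrow> 'f mat" where
  "slice X k = map_mat (\<lambda>q. pi_map q k) X"

text \<open>
  The products of slices and their conjugate transposes have uniformly bounded entries, hence,
  \<open>\<pi>\<close> being a bijection onto the bounded sequences, the tensors described below exist and are
  unique.
\<close>

definition tprod :: "('h \<Rightarrow> 'h) mat \<Rightarrow> ('h \<Rightarrow> 'h) mat \<Rightarrow> ('h \<Rightarrow> 'h) mat" where
  "tprod X Y = (THE Z. Z \<in> tensors (dim_row X) (dim_col Y) \<and>
     (\<forall>k. slice Z k = slice X k * slice Y k))"

definition tadjoint :: "('h \<Rightarrow> 'h) mat \<Rightarrow> ('h \<Rightarrow> 'h) mat" where
  "tadjoint X = (THE Z. Z \<in> tensors (dim_col X) (dim_row X) \<and>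
     (\<forall>k. slice Z k = mat_adjoint (slice X k)))"

definition tid :: "nat \<Rightarrow> ('h \<Rightarrow> 'h) mat" where
  "tid n = mat n n (\<lambda>(i, j). if i = j then id else (\<lambda>x. 0))"

definition tunitary :: "nat \<Rightarrow> ('h \<Rightarrow> 'h) mat \<Rightarrow> bool" where
  "tunitary n U \<longleftrightarrow> U \<in> tensors n n \<and>
     tprod (tadjoint U) U = tid n \<and> tprod U (tadjoint U) = tid n"

definition f_diagonal :: "('h \<Rightarrow> 'h) mat \<Rightarrow> bool" where
  "f_diagonal S \<longleftrightarrow> (\<forall>k. diagonal_mat (slice S k))"

end

end

theory Submission
  imports Defs
begin

text \<open>
  A quasitube is the multiplier operator of a bounded sequence of scalars, so it suffices to take a
  singular value decomposition of each slice, with uniformly bounded factors; unitary matrices have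
  entries of modulus at most 1, and then \<open>S = U\<^sup>* A V\<close> is bounded too. The order on quasitubes is
  the entrywise one on real sequences.

  For a single \<open>m \<times> p\<close> matrix \<open>A\<close>, maximise \<open>\<Sum>\<^sub>k w\<^sub>k Re B\<^sub>k\<^sub>k\<close> over all unitary \<open>U\<close>, \<open>V\<close>, where
  \<open>B = U\<^sup>* A V\<close> and \<open>w\<^sub>1 > w\<^sub>2 > \<dots> > 0\<close>; the maximum exists by compactness. Rotating two columns of
  \<open>V\<close> shows \<open>w\<^sub>i B\<^sub>i\<^sub>j = w\<^sub>j cnj B\<^sub>j\<^sub>i\<close> at a maximum, and rotating two columns of \<open>U\<close> shows
  \<open>w\<^sub>j B\<^sub>i\<^sub>j = w\<^sub>i cnj B\<^sub>j\<^sub>i\<close>, so \<open>B\<^sub>i\<^sub>j = 0\<close>. Multiplying a column by a phase gives \<open>B\<^sub>i\<^sub>i \<ge> 0\<close>,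
  and swapping two columns in both \<open>U\<close> and \<open>V\<close> gives the ordering.
\<close>

subsection \<open>Scalars\<close>

text \<open>By polarisation; it avoids a case distinction between \<open>\<real>\<close> and \<open>\<complex>\<close>.\<close>

definition real_part :: "'f::real_or_complex \<Rightarrow> real" where
  "real_part x = ((norm (x + 1))\<^sup>2 - (norm (x - 1))\<^sup>2) / 4"

lemma mult_conjugate_of_real:
  fixes x :: "'f::real_or_complex"
  shows "x * conjugate x = of_real ((norm x)\<^sup>2)"
  by (simp only: mult_conjugate of_real_def)

lemma conjugate_one [simp]: "conjugate (1::'f::real_or_complex) = 1"
  using conjugate_dist_mul[of "conjugate 1 :: 'f" 1] by simp

text \<open>The product of a real scalar with its conjugate is its square, so cancelling one factor
  shows that conjugation fixes the reals.\<close>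

lemma conjugate_of_real [simp]: "conjugate (of_real r :: 'f::real_or_complex) = of_real r"
proof (cases "r = 0")
  case False
  have "(of_real r :: 'f) * conjugate (of_real r) = of_real r * of_real r"
    unfolding mult_conjugate_of_real by (simp add: power2_eq_square flip: of_real_mult)
  with False show ?thesis by simp
qed simp

lemma conjugate_diff: "conjugate (x - y) = conjugate x - conjugate (y::'f::real_or_complex)"
  by (simp only: diff_conv_add_uminus conjugate_dist_add conjugate_neg)

lemma conjugate_mult_of_real:
  fixes x :: "'f::real_or_complex"
  shows "conjugate x * x = of_real ((norm x)\<^sup>2)"
  by (simp only: mult_conjugate_of_real mult.commute[of "conjugate x"])

lemma norm_conjugate [simp]: "norm (conjugate x) = norm (x::'f::real_or_complex)"
proof -
  have "(of_real ((norm (conjugate x))\<^sup>2) :: 'f) = of_real ((norm x)\<^sup>2)"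
    unfolding mult_conjugate_of_real[symmetric] by (simp add: mult.commute)
  then show ?thesis by (simp del: of_real_power)
qed

lemma bounded_linear_conjugate: "bounded_linear (conjugate :: 'f::real_or_complex \<Rightarrow> 'f)"
proof (rule bounded_linear_intro[where K = 1])
  fix r and x :: 'f
  show "conjugate (r *\<^sub>R x) = r *\<^sub>R conjugate x"
    by (simp add: scaleR_conv_of_real conjugate_dist_mul)
qed (simp_all add: conjugate_dist_add)

lemmas continuous_on_conjugate [continuous_intros] =
  bounded_linear.continuous_on[OF bounded_linear_conjugate]

text \<open>Expanding the two squared norms in \<open>real_part\<close> as products with conjugates
  leaves \<open>2 * (x + conjugate x)\<close>. Every later property of \<open>real_part\<close> is
  read off from this identity.\<close>

lemma of_real_real_part:
  fixes x :: "'f::real_or_complex"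
  shows "of_real (2 * real_part x) = x + conjugate x"
proof -
  have "(of_real (4 * real_part x) :: 'f) = 2 * (x + conjugate x)"
    unfolding real_part_def
    by (simp add: mult_conjugate_of_real[symmetric] conjugate_dist_add conjugate_diff algebra_simps
        del: of_real_power)
  then have "(2::'f) * of_real (2 * real_part x) = 2 * (x + conjugate x)"
    by (simp add: algebra_simps)
  then show ?thesis unfolding mult_cancel_left by auto
qed

lemma real_part_eqI:
  fixes x :: "'f::real_or_complex"
  assumes "x + conjugate x = of_real (2 * r)"
  shows "real_part x = r"
proof -
  have "(of_real (2 * real_part x) :: 'f) = of_real (2 * r)"
    using assms of_real_real_part[of x] by (simp only:)
  then have "2 * real_part x = 2 * r" unfolding of_real_eq_iff .
  then show ?thesis by linarith
qed

lemma real_part_add [simp]: "real_part (x + y) = real_part x + real_part (y::'f::real_or_complex)"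
proof (rule real_part_eqI)
  have "x + y + conjugate (x + y) = (x + conjugate x) + (y + conjugate y)"
    by (simp add: conjugate_dist_add)
  also have "\<dots> = of_real (2 * real_part x) + of_real (2 * real_part y)"
    by (simp only: of_real_real_part)
  finally show "x + y + conjugate (x + y) = of_real (2 * (real_part x + real_part y))"
    by (simp only: distrib_left of_real_add)
qed

lemma real_part_of_real_mult [simp]: "real_part (of_real r * x) = r * real_part (x::'f::real_or_complex)"
proof (rule real_part_eqI)
  have "of_real r * x + conjugate (of_real r * x) = of_real r * (x + conjugate x)"
    by (simp add: conjugate_dist_mul algebra_simps)
  then show "of_real r * x + conjugate (of_real r * x) = of_real (2 * (r * real_part x))"
    by (simp add: of_real_real_part[symmetric])
qed

lemma real_part_diff [simp]: "real_part (x - y) = real_part x - real_part (y::'f::real_or_complex)"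
  using real_part_add[of "x - y" y] by simp

lemma real_part_conjugate [simp]: "real_part (conjugate x) = real_part (x::'f::real_or_complex)"
  by (rule real_part_eqI) (simp only: conjugate_id of_real_real_part add.commute)

lemma real_part_of_real [simp]: "real_part (of_real r :: 'f::real_or_complex) = r"
  by (rule real_part_eqI) simp

lemma abs_real_part_le: "\<bar>real_part x\<bar> \<le> norm (x::'f::real_or_complex)"
proof -
  have "norm (of_real (2 * real_part x) :: 'f) \<le> norm x + norm (conjugate x)"
    unfolding of_real_real_part by (rule norm_triangle_ineq)
  then show ?thesis by simp
qed

lemma continuous_on_real_part [continuous_intros]:
  "continuous_on S f \<Longrightarrow> continuous_on S (\<lambda>x. real_part (f x :: 'f::real_or_complex))"
  unfolding real_part_def by (intro continuous_intros) auto

lemma exists_phase: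
  fixes x :: "'f::real_or_complex"
  obtains z where "norm z = 1" "z * x = of_real (norm x)"
proof (cases "x = 0")
  case True
  then show ?thesis using that[of 1] by simp
next
  case False
  show ?thesis
  proof (rule that)
    show "norm (conjugate x / of_real (norm x)) = 1"
      using False by (simp add: norm_divide)
    show "conjugate x / of_real (norm x) * x = of_real (norm x)"
      using False by (simp add: conjugate_mult_of_real power2_eq_square)
  qed
qed

text \<open>The squared distance from \<open>x\<close> to \<open>norm x\<close> expands to
  \<open>2 * norm x * (norm x - real_part x)\<close>, which vanishes in this equality case.\<close>

lemma norm_le_real_part_imp:
  fixes x :: "'f::real_or_complex"
  assumes "norm x \<le> real_part x"
  shows "x = of_real (norm x)"
proof -
  have eq: "norm x = real_part x" using assms abs_real_part_le[of x] by simp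
  have "(of_real ((norm (x - of_real (norm x)))\<^sup>2) :: 'f)
      = x * conjugate x + of_real (norm x) * of_real (norm x) - of_real (norm x) * (x + conjugate x)"
    unfolding mult_conjugate_of_real[symmetric] by (simp add: conjugate_diff algebra_simps)
  also have "\<dots> = of_real ((norm x)\<^sup>2 + norm x * norm x - norm x * (2 * real_part x))"
    by (simp only: mult_conjugate_of_real of_real_real_part[symmetric] of_real_add of_real_diff of_real_mult)
  also have "\<dots> = 0" by (simp add: eq power2_eq_square)
  finally show ?thesis by simp
qed

text \<open>The class axiom describes the field by one or two real coordinates, each bounded by the
  norm. The ball is thus a closed subset of the continuous image of a compact box.\<close>

lemma compact_cball_real_or_complex: "compact (cball (0::'f::real_or_complex) r)"
proof -
  have *: "compact (cball (0::'f) r)" if "continuous_on K f" "compact K" "cball 0 r \<subseteq> f ` K"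
    for K :: "(real \<times> real) set" and f :: "real \<times> real \<Rightarrow> 'f"
  proof -
    have "cball (0::'f) r = cball 0 r \<inter> f ` K" using that by auto
    also have "compact \<dots>"
      by (intro closed_Int_compact compact_continuous_image that closed_cball)
    finally show ?thesis .
  qed
  consider "\<forall>x::'f. \<exists>a. x = a *\<^sub>R 1"
    | i :: 'f where "i * i = - 1" "\<forall>x. \<exists>a b. x = a *\<^sub>R 1 + b *\<^sub>R i"
    using real_or_complex by blast
  then show ?thesis
  proof cases
    case 1
    show ?thesis
    \<comment> \<open>The second coordinate is a dummy held at 0, so that both cases share the
      auxiliary fact.\<close>
    proof (rule *[where K = "cbox (-r, 0) (r, 0)" and f = "\<lambda>(a, b). a *\<^sub>R 1"])
      show "cball 0 r \<subseteq> (\<lambda>(a, b). a *\<^sub>R (1::'f)) ` cbox (-r, 0) (r, 0::real)"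
      proof
        fix x :: 'f assume x: "x \<in> cball 0 r"
        obtain a where "x = a *\<^sub>R 1" using 1 by blast
        with x have "(a, 0) \<in> cbox (-r, 0) (r, 0::real)" by (auto simp: cbox_Pair_eq)
        then show "x \<in> (\<lambda>(a, b). a *\<^sub>R (1::'f)) ` cbox (-r, 0) (r, 0::real)"
          using \<open>x = a *\<^sub>R 1\<close> by force
      qed
    qed (auto simp: case_prod_unfold intro!: continuous_intros)
  next
    case (2 i)
    have "(norm i)\<^sup>2 = 1"
      using arg_cong[OF 2(1), of norm] by (simp add: norm_mult power2_eq_square)
    then have ni: "norm i = 1"
      using norm_ge_zero[of i] unfolding power2_eq_1_iff by linarith
    \<comment> \<open>Both \<open>i * conjugate i\<close> and \<open>i * (- i)\<close> equal 1.
      Hence \<open>i\<close> has real part 0, and the coordinates of a point are the real parts of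
      the point and of its product with \<open>- i\<close>.\<close>
    have ci: "conjugate i = - i"
    proof -
      have "i * conjugate i = i * (- i)" using 2(1) ni by (simp add: mult_conjugate_of_real)
      then show ?thesis using ni unfolding mult_cancel_left by auto
    qed
    have "real_part i = 0" by (rule real_part_eqI) (simp add: ci)
    have rei: "real_part (a *\<^sub>R 1 + b *\<^sub>R i) = a" for a b
      using \<open>real_part i = 0\<close> by (simp add: scaleR_conv_of_real)
    have imi: "real_part (- i * (a *\<^sub>R 1 + b *\<^sub>R i)) = b" for a b
    proof -
      have "- i * (a *\<^sub>R 1 + b *\<^sub>R i) = of_real (-a) * i - of_real b * (i * i)"
        by (simp add: scaleR_conv_of_real algebra_simps)
      then show ?thesis using \<open>real_part i = 0\<close> by (simp add: 2(1) del: of_real_minus)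
    qed
    show ?thesis
    proof (rule *[where K = "cbox (-r, -r) (r, r)" and f = "\<lambda>(a, b). a *\<^sub>R 1 + b *\<^sub>R i"])
      show "cball 0 r \<subseteq> (\<lambda>(a, b). a *\<^sub>R 1 + b *\<^sub>R i) ` cbox (-r, -r) (r, r)"
      proof
        fix x :: 'f assume x: "x \<in> cball 0 r"
        obtain a b where ab: "x = a *\<^sub>R 1 + b *\<^sub>R i" using 2(2) by blast
        have "\<bar>a\<bar> \<le> norm x" using abs_real_part_le[of x] unfolding ab rei .
        moreover have "\<bar>b\<bar> \<le> norm x" using abs_real_part_le[of "- i * x"]
          unfolding ab imi norm_mult norm_minus_cancel ni by simp
        ultimately have "(a, b) \<in> cbox (-r, -r) (r, r)" using x by (auto simp: cbox_Pair_eq)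
        then show "x \<in> (\<lambda>(a, b). a *\<^sub>R 1 + b *\<^sub>R i) ` cbox (-r, -r) (r, r)"
          using ab by force
      qed
    qed (auto simp: case_prod_unfold intro!: continuous_intros)
  qed
qed

subsection \<open>Orthonormal systems in coordinate space\<close>

text \<open>\<open>V k a\<close> is coordinate \<open>a\<close> of vector \<open>k\<close>; values
  outside the \<open>n\<close> by \<open>n\<close> block are unconstrained. Functions carry the
  product topology, and replacing a vector is a function update.\<close>

definition orthonormal_systems :: "nat \<Rightarrow> (nat \<Rightarrow> nat \<Rightarrow> 'f::real_or_complex) set" where
  "orthonormal_systems n =
    {V. \<forall>k<n. \<forall>l<n. (\<Sum>a<n. V k a * conjugate (V l a)) = (if k = l then 1 else 0)}"

lemma orthonormal_systems_iff:
  "V \<in> orthonormal_systems n \<longleftrightarrow>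
    (\<forall>k<n. \<forall>l<n. (\<Sum>a<n. V k a * conjugate (V l a)) = (if k = l then 1 else 0))"
  by (simp add: orthonormal_systems_def)

lemma orthonormal_systemsD:
  assumes "V \<in> orthonormal_systems n" "k < n" "l < n"
  shows "(\<Sum>a<n. V k a * conjugate (V l a)) = (if k = l then 1 else 0)"
  using assms by (simp add: orthonormal_systems_iff)

lemma norm_orthonormal_systems_le:
  fixes V :: "nat \<Rightarrow> nat \<Rightarrow> 'f::real_or_complex"
  assumes "V \<in> orthonormal_systems n" "k < n" "a < n"
  shows "norm (V k a) \<le> 1"
proof -
  have "(of_real (\<Sum>a<n. (norm (V k a))\<^sup>2) :: 'f) = (\<Sum>a<n. V k a * conjugate (V k a))"
    by (simp only: mult_conjugate_of_real of_real_sum)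
  also have "\<dots> = of_real 1"
    using assms(1,2) by (simp add: orthonormal_systems_iff)
  finally have "(\<Sum>a<n. (norm (V k a))\<^sup>2) = 1"
    unfolding of_real_eq_iff .
  moreover have "(norm (V k a))\<^sup>2 \<le> (\<Sum>a<n. (norm (V k a))\<^sup>2)"
    using assms(3) by (intro member_le_sum) auto
  ultimately have "(norm (V k a))\<^sup>2 \<le> 1\<^sup>2" by simp
  then show ?thesis by (rule power2_le_imp_le) simp
qed

lemma orthonormal_systems_cong:
  assumes "\<And>k a. k < n \<Longrightarrow> a < n \<Longrightarrow> V k a = V' k a"
  shows "V \<in> orthonormal_systems n \<longleftrightarrow> V' \<in> orthonormal_systems n"
proof -
  have "(\<Sum>a<n. V k a * conjugate (V l a)) = (\<Sum>a<n. V' k a * conjugate (V' l a))"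
    if "k < n" "l < n" for k l
    using that assms by (intro sum.cong) auto
  then show ?thesis by (simp add: orthonormal_systems_iff cong: conj_cong)
qed

lemma orthonormal_systems_comp:
  assumes V: "V \<in> orthonormal_systems n" and inj: "inj_on \<sigma> {..<n}" and sub: "\<sigma> ` {..<n} \<subseteq> {..<n}"
  shows "(\<lambda>k. V (\<sigma> k)) \<in> orthonormal_systems n"
  unfolding orthonormal_systems_iff
proof (intro allI impI)
  fix k l assume kl: "k < n" "l < n"
  then have "\<sigma> k < n" "\<sigma> l < n" using sub by auto
  moreover have "\<sigma> k = \<sigma> l \<longleftrightarrow> k = l" using inj kl by (auto simp: inj_on_def)
  ultimately show "(\<Sum>a<n. V (\<sigma> k) a * conjugate (V (\<sigma> l) a)) = (if k = l then 1 else 0)"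
    using orthonormal_systemsD[OF V, of "\<sigma> k" "\<sigma> l"] by simp
qed

text \<open>The pair \<open>V i\<close>, \<open>V j\<close> is transformed by the matrix with rows
  \<open>(c, s)\<close> and \<open>(- conjugate s, c)\<close>, which is unitary by the hypotheses on
  \<open>c\<close> and \<open>s\<close>; the plane that the pair spans is preserved.\<close>

lemma orthonormal_systems_rotate:
  fixes V :: "nat \<Rightarrow> nat \<Rightarrow> 'f::real_or_complex"
  assumes V: "V \<in> orthonormal_systems n" and ij: "i < n" "j < n" "i \<noteq> j"
    and c: "conjugate c = c" "c * c + s * conjugate s = 1"
  shows "V(i := (\<lambda>a. c * V i a + s * V j a), j := (\<lambda>a. - conjugate s * V i a + c * V j a))
    \<in> orthonormal_systems n" (is "?V' \<in> _")
proof -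
  define P where "P v w = (\<Sum>a<n. v a * conjugate (w a))" for v w :: "nat \<Rightarrow> 'f"
  have l: "P (\<lambda>a. \<alpha> * v a + \<beta> * v' a) w = \<alpha> * P v w + \<beta> * P v' w" for \<alpha> \<beta> v v' w
    by (simp add: P_def sum.distrib sum_distrib_left algebra_simps)
  have r: "P w (\<lambda>a. \<alpha> * v a + \<beta> * v' a) = conjugate \<alpha> * P w v + conjugate \<beta> * P w v'" for \<alpha> \<beta> v v' w
    by (simp add: P_def sum.distrib sum_distrib_left algebra_simps conjugate_dist_add conjugate_dist_mul)
  have o: "P (V k) (V l) = (if k = l then 1 else 0)" if "k < n" "l < n" for k l
    using V that by (simp add: orthonormal_systems_iff P_def)
  define t where "t = - conjugate s"
  have t: "conjugate t * c + c * s = 0" "c * t + conjugate s * c = 0" "t * conjugate t + c * c = 1"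
    using c(2) by (simp_all add: t_def conjugate_neg algebra_simps)
  have "P (?V' k) (?V' l) = (if k = l then 1 else 0)" if "k < n" "l < n" for k l
    using that ij c t unfolding t_def[symmetric] by (auto simp: l r o)
  then show ?thesis unfolding orthonormal_systems_iff P_def by blast
qed

lemma orthonormal_systems_phase:
  fixes V :: "nat \<Rightarrow> nat \<Rightarrow> 'f::real_or_complex"
  assumes V: "V \<in> orthonormal_systems n" and z: "norm z = 1"
  shows "V(i := (\<lambda>a. z * V i a)) \<in> orthonormal_systems n" (is "?V' \<in> _")
  unfolding orthonormal_systems_iff
proof (intro allI impI)
  fix k l assume kl: "k < n" "l < n"
  have zz: "z * conjugate z = 1" using z by (simp add: mult_conjugate_of_real)
  define \<alpha> where "\<alpha> k = (if k = i then z else 1)" for k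
  have "(\<Sum>a<n. ?V' k a * conjugate (?V' l a))
      = (\<Sum>a<n. (\<alpha> k * conjugate (\<alpha> l)) * (V k a * conjugate (V l a)))"
    by (rule sum.cong) (auto simp: \<alpha>_def conjugate_dist_mul algebra_simps)
  also have "\<dots> = \<alpha> k * conjugate (\<alpha> l) * (if k = l then 1 else 0)"
    unfolding sum_distrib_left[symmetric] orthonormal_systemsD[OF V kl] ..
  also have "\<dots> = (if k = l then 1 else 0)" by (simp add: \<alpha>_def zz)
  finally show "(\<Sum>a<n. ?V' k a * conjugate (?V' l a)) = (if k = l then 1 else 0)" .
qed

section \<open>Compactness and existence of maximisers\<close>

lemma compact_product_UNIV:
  fixes S :: "'i \<Rightarrow> 'a::topological_space set"
  assumes "\<And>i. compact (S i)"
  shows "compact {f. \<forall>i. f i \<in> S i}"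
proof -
  have "compactin (product_topology (\<lambda>i. euclidean) UNIV) (PiE UNIV S)"
    unfolding compactin_PiE using assms by simp
  moreover have "PiE UNIV S = {f. \<forall>i. f i \<in> S i}" by auto
  ultimately show ?thesis
    by (simp add: euclidean_product_topology)
qed

lemma continuous_on_entry:
  fixes S :: "('i \<Rightarrow> 'j \<Rightarrow> 'a::topological_space) set"
  shows "continuous_on S (\<lambda>V. V k a)"
proof -
  have "continuous_on S (\<lambda>V. V k)"
    by (rule continuous_on_subset[OF continuous_on_product_coordinates]) simp
  then show ?thesis by (rule continuous_on_product_then_coordinatewise)
qed

lemma continuous_on_fst_entry:
  fixes S :: "(('i \<Rightarrow> 'j \<Rightarrow> 'a::topological_space) \<times> 'b::topological_space) set"
  shows "continuous_on S (\<lambda>x. fst x k a)"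
  by (rule continuous_on_compose2[OF continuous_on_entry continuous_on_fst[OF continuous_on_id]]) auto

lemma continuous_on_snd_entry:
  fixes S :: "('b::topological_space \<times> ('i \<Rightarrow> 'j \<Rightarrow> 'a::topological_space)) set"
  shows "continuous_on S (\<lambda>x. snd x k a)"
  by (rule continuous_on_compose2[OF continuous_on_entry continuous_on_snd[OF continuous_on_id]]) auto

lemma closed_orthonormal_systems:
  "closed (orthonormal_systems n :: (nat \<Rightarrow> nat \<Rightarrow> 'f::real_or_complex) set)"
proof -
  have "orthonormal_systems n = (\<Inter>k\<in>{..<n}. \<Inter>l\<in>{..<n}.
      {V :: nat \<Rightarrow> nat \<Rightarrow> 'f. (\<Sum>a<n. V k a * conjugate (V l a)) = (if k = l then 1 else 0)})"
    by (auto simp: orthonormal_systems_iff)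
  also have "closed \<dots>"
    by (intro closed_INT ballI closed_Collect_eq continuous_intros continuous_on_entry)
  finally show ?thesis .
qed

text \<open>The entries outside the block are free, so the systems themselves do not form a compact
  set. Those vanishing outside the block do, and by \<open>cong\<close> the function
  \<open>f\<close> does not see the truncation \<open>cut\<close>.\<close>

lemma orthonormal_systems_attain_max:
  fixes f :: "(nat \<Rightarrow> nat \<Rightarrow> 'f::real_or_complex) \<Rightarrow> (nat \<Rightarrow> nat \<Rightarrow> 'f) \<Rightarrow> real"
  assumes cont: "continuous_on UNIV (\<lambda>x. f (fst x) (snd x))"
    and cong: "\<And>U U' V V'. (\<And>k a. k < m \<Longrightarrow> a < m \<Longrightarrow> U k a = U' k a) \<Longrightarrow>
      (\<And>k a. k < p \<Longrightarrow> a < p \<Longrightarrow> V k a = V' k a) \<Longrightarrow> f U V = f U' V'"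
  shows "\<exists>U\<in>orthonormal_systems m. \<exists>V\<in>orthonormal_systems p.
    \<forall>U'\<in>orthonormal_systems m. \<forall>V'\<in>orthonormal_systems p. f U' V' \<le> f U V"
proof -
  define K where "K n = {V :: nat \<Rightarrow> nat \<Rightarrow> 'f. \<forall>k. V k \<in>
      {v. \<forall>a. v a \<in> (if k < n \<and> a < n then cball 0 1 else {0})}}" for n
  define C where "C n = K n \<inter> orthonormal_systems n" for n
  define cut where "cut n V k a = (if k < n \<and> a < n then V k a else 0)"
    for n and V :: "nat \<Rightarrow> nat \<Rightarrow> 'f" and k a
  have "compact (C n)" for n
    unfolding C_def K_def
    by (intro compact_Int_closed compact_product_UNIV closed_orthonormal_systems)
      (simp add: compact_cball_real_or_complex)
  then have "compact (C m \<times> C p)" by (intro compact_Times)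
  have cut: "cut n V \<in> C n" if "V \<in> orthonormal_systems n" for n V
    using that norm_orthonormal_systems_le[OF that] orthonormal_systems_cong[of n V "cut n V"]
    by (auto simp: C_def K_def cut_def)
  \<comment> \<open>The standard basis shows that the compact set is nonempty, as attaining a
    maximum requires.\<close>
  have "(\<lambda>k a. if k = a then 1 else 0 :: 'f) \<in> orthonormal_systems n" for n
    unfolding orthonormal_systems_iff
  proof (intro allI impI)
    fix k l assume "k < n" "l < n"
    have "(\<Sum>a<n. (if k = a then 1 else 0) * conjugate (if l = a then 1 else 0))
        = (\<Sum>a<n. if k = a then (if k = l then 1 else 0) else (0 :: 'f))"
      by (rule sum.cong) auto
    then show "(\<Sum>a<n. (if k = a then 1 else 0) * conjugate (if l = a then 1 else 0))
        = (if k = l then 1 else (0 :: 'f))"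
      using \<open>k < n\<close> by simp
  qed
  then have "C n \<noteq> {}" for n using cut by blast
  then have "C m \<times> C p \<noteq> {}" by auto
  then obtain x where x: "x \<in> C m \<times> C p"
    "\<forall>y\<in>C m \<times> C p. f (fst y) (snd y) \<le> f (fst x) (snd x)"
    using continuous_attains_sup[OF \<open>compact (C m \<times> C p)\<close>, of "\<lambda>x. f (fst x) (snd x)"]
      continuous_on_subset[OF cont] by blast
  show ?thesis
  proof (intro bexI ballI)
    show "fst x \<in> orthonormal_systems m" "snd x \<in> orthonormal_systems p"
      using x(1) by (auto simp: C_def)
    fix U' V' :: "nat \<Rightarrow> nat \<Rightarrow> 'f"
    assume "U' \<in> orthonormal_systems m" "V' \<in> orthonormal_systems p"
    then have "(cut m U', cut p V') \<in> C m \<times> C p" using cut by auto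
    then have "f (cut m U') (cut p V') \<le> f (fst x) (snd x)" using x(2) by fastforce
    moreover have "f (cut m U') (cut p V') = f U' V'" by (rule cong) (simp_all add: cut_def)
    ultimately show "f U' V' \<le> f (fst x) (snd x)" by simp
  qed
qed

lemma sum_eq_two_plus_rest:
  assumes "finite A" "i \<in> A" "j \<in> A" "i \<noteq> j"
  shows "sum f A = f i + f j + sum f (A - {i, j})"
proof -
  have "sum f A = f i + (f j + sum f (A - {i} - {j}))"
    using assms by (simp add: sum.remove[of A i] sum.remove[of "A - {i}" j])
  then show ?thesis by (simp add: add.assoc Diff_insert2[symmetric])
qed

subsection \<open>Singular value decomposition of a matrix\<close>

text \<open>A first-order condition obtained without derivatives. Let \<open>x\<close> be the
  difference of the two sides. Rotating \<open>V i\<close> and \<open>V j\<close> by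
  \<open>(c, s)\<close> changes the two affected terms from \<open>\<alpha>\<close> to
  \<open>c * \<alpha> + s * norm x\<close>. Maximality bounds this by \<open>\<alpha>\<close> on the
  whole unit circle, where its maximum is \<open>sqrt (\<alpha>^2 + (norm x)^2)\<close>, so
  \<open>x = 0\<close>. The abstract \<open>g\<close> allows the use for either factor of the
  decomposition.\<close>

lemma max_weighted_trace_offdiag:
  fixes V :: "nat \<Rightarrow> nat \<Rightarrow> 'f::real_or_complex"
  assumes V: "V \<in> orthonormal_systems n" and ij: "i < n" "j < n" "i \<noteq> j" and N: "n \<le> N"
    and lin: "\<And>k \<alpha> \<beta> v v'. g k (\<lambda>a. \<alpha> * v a + \<beta> * v' a) = \<alpha> * g k v + \<beta> * (g k v' :: 'f)"
    and max: "\<And>V'. V' \<in> orthonormal_systems n \<Longrightarrow>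
      (\<Sum>k<N. w k * real_part (g k (V' k))) \<le> (\<Sum>k<N. w k * real_part (g k (V k)))"
  shows "of_real (w i) * g i (V j) = of_real (w j) * conjugate (g j (V i))"
proof -
  define x where "x = of_real (w i) * g i (V j) - of_real (w j) * conjugate (g j (V i))"
  define \<alpha> where "\<alpha> = w i * real_part (g i (V i)) + w j * real_part (g j (V j))"
  obtain z where z: "norm z = 1" "z * x = of_real (norm x)" using exists_phase by blast
  have zz: "z * conjugate z = 1" using z by (simp add: mult_conjugate_of_real)
  \<comment> \<open>The phase \<open>z\<close> makes the cross term real. Conjugation does not
    change real parts, so the coefficient of \<open>s\<close> is exactly
    \<open>norm x\<close>.\<close>
  have "real_part (z * x) = norm x" using z(2) by simp
  moreover have "z * x = of_real (w i) * (z * g i (V j))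
      - of_real (w j) * conjugate (conjugate z * g j (V i))"
    by (simp add: x_def conjugate_dist_mul algebra_simps)
  ultimately have b: "w i * real_part (z * g i (V j)) - w j * real_part (conjugate z * g j (V i)) = norm x"
    by simp
  have *: "c * \<alpha> + s * norm x \<le> \<alpha>" if cs: "c * c + s * s = 1" for c s
  proof -
    define C where "C = (of_real c :: 'f)"
    define S where "S = of_real s * z"
    define V' where "V' = V(i := (\<lambda>a. C * V i a + S * V j a),
      j := (\<lambda>a. - conjugate S * V i a + C * V j a))"
    have "S * conjugate S = (of_real s * of_real s) * (z * conjugate z)"
      by (simp add: S_def conjugate_dist_mul algebra_simps)
    then have "C * C + S * conjugate S = of_real (c * c + s * s)"
      by (simp add: C_def zz)
    then have V': "V' \<in> orthonormal_systems n"
      unfolding V'_def using cs by (intro orthonormal_systems_rotate V ij) (simp_all add: C_def)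
    have "w i * real_part (g i (V' i)) + w j * real_part (g j (V' j)) \<le> \<alpha>"
    proof -
      have "(\<Sum>k\<in>{..<N} - {i, j}. w k * real_part (g k (V' k))) = (\<Sum>k\<in>{..<N} - {i, j}. w k * real_part (g k (V k)))"
        by (rule sum.cong) (auto simp: V'_def)
      then show ?thesis
        using max[OF V'] ij N
        by (simp add: \<alpha>_def sum_eq_two_plus_rest[of "{..<N}" i j])
    qed
    moreover have "real_part (g i (V' i)) = c * real_part (g i (V i)) + s * real_part (z * g i (V j))"
    proof -
      have "g i (V' i) = of_real c * g i (V i) + of_real s * (z * g i (V j))"
        using ij lin[of i C "V i" S "V j"] by (simp add: V'_def C_def S_def mult.assoc)
      then show ?thesis by simp
    qed
    moreover have "real_part (g j (V' j)) = c * real_part (g j (V j)) - s * real_part (conjugate z * g j (V i))"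
    proof -
      have "g j (V' j) = of_real c * g j (V j) - of_real s * (conjugate z * g j (V i))"
        using lin[of j "- conjugate S" "V i" C "V j"]
        by (simp add: V'_def C_def S_def mult.assoc conjugate_dist_mul)
      then show ?thesis by simp
    qed
    ultimately show ?thesis using b by (simp add: \<alpha>_def algebra_simps flip: b)
  qed
  have "norm x = 0"
  proof (rule ccontr)
    assume x0: "norm x \<noteq> 0"
    \<comment> \<open>On the unit circle the maximum \<open>r\<close> of
      \<open>c * \<alpha> + s * norm x\<close> is attained at \<open>c = \<alpha> / r\<close>,
      \<open>s = norm x / r\<close>.\<close>
    define r where "r = sqrt (\<alpha>\<^sup>2 + (norm x)\<^sup>2)"
    have r2: "r * r = \<alpha> * \<alpha> + norm x * norm x"
      unfolding r_def by (simp add: power2_eq_square)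
    have "r > 0" unfolding r_def using x0 by (simp add: sum_power2_gt_zero_iff)
    have "\<alpha> / r * (\<alpha> / r) + norm x / r * (norm x / r) = 1"
    proof -
      have "\<alpha> / r * (\<alpha> / r) + norm x / r * (norm x / r) = r * r / (r * r)"
        unfolding times_divide_times_eq add_divide_distrib[symmetric] r2 ..
      then show ?thesis using \<open>r > 0\<close> by simp
    qed
    from *[OF this] have "\<alpha> * \<alpha> / r + norm x * norm x / r \<le> \<alpha>" by simp
    then have "r * r / r \<le> \<alpha>" unfolding r2 add_divide_distrib .
    then have "r \<le> \<alpha>" using \<open>r > 0\<close> by simp
    then have "r * r \<le> \<alpha> * \<alpha>" using \<open>r > 0\<close> by (intro mult_mono) auto
    then show False using r2 x0 by (auto simp: mult_le_0_iff)
  qed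
  then show ?thesis by (simp add: x_def)
qed

text \<open>A phase on \<open>V i\<close> can turn \<open>g i (V i)\<close> into its norm. As
  \<open>w i > 0\<close>, maximality forces the real part to be at least the norm already.\<close>

lemma max_weighted_trace_diag:
  fixes V :: "nat \<Rightarrow> nat \<Rightarrow> 'f::real_or_complex"
  assumes V: "V \<in> orthonormal_systems n" and i: "i < N" "w i > 0"
    and lin: "\<And>k \<alpha> v. g k (\<lambda>a. \<alpha> * v a) = \<alpha> * (g k v :: 'f)"
    and max: "\<And>V'. V' \<in> orthonormal_systems n \<Longrightarrow>
      (\<Sum>k<N. w k * real_part (g k (V' k))) \<le> (\<Sum>k<N. w k * real_part (g k (V k)))"
  shows "g i (V i) = of_real (norm (g i (V i)))"
proof (rule norm_le_real_part_imp)
  obtain z where z: "norm z = 1" "z * g i (V i) = of_real (norm (g i (V i)))"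
    using exists_phase by blast
  define V' where "V' = V(i := (\<lambda>a. z * V i a))"
  have "V' \<in> orthonormal_systems n" unfolding V'_def by (rule orthonormal_systems_phase[OF V z(1)])
  note max' = max[OF this]
  have "(\<Sum>k\<in>{..<N} - {i}. w k * real_part (g k (V' k))) = (\<Sum>k\<in>{..<N} - {i}. w k * real_part (g k (V k)))"
    by (rule sum.cong) (auto simp: V'_def)
  then have "w i * real_part (g i (V' i)) \<le> w i * real_part (g i (V i))"
    using max' i by (simp add: sum.remove[of _ i])
  then show "norm (g i (V i)) \<le> real_part (g i (V i))"
    using i by (simp add: V'_def lin z)
qed

section \<open>Conjugate transposes, unitary matrices and the decomposition\<close>

lemma mat_adjoint_carrier [simp]: "A \<in> carrier_mat m p \<Longrightarrow> mat_adjoint A \<in> carrier_mat p m"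
  unfolding mat_adjoint_def by auto

lemma dim_mat_adjoint [simp]:
  "dim_row (mat_adjoint A) = dim_col A" "dim_col (mat_adjoint A) = dim_row A"
  unfolding mat_adjoint_def by auto

lemma mat_adjoint_index [simp]:
  "i < dim_col A \<Longrightarrow> j < dim_row A \<Longrightarrow> mat_adjoint A $$ (i, j) = conjugate (A $$ (j, i))"
  unfolding mat_adjoint_def by (simp add: mat_of_rows_index)

text \<open>The vectors become the columns of \<open>W\<close>, which gives the first identity; a
  left inverse of a square matrix over a field is also a right inverse.\<close>

lemma mat_of_orthonormal_system:
  assumes "V \<in> orthonormal_systems n"
  defines "W \<equiv> mat n n (\<lambda>(a, k). V k a)"
  shows "mat_adjoint W * W = 1\<^sub>m n" "W * mat_adjoint W = 1\<^sub>m n"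
proof -
  have W: "W \<in> carrier_mat n n" by (simp add: W_def)
  note aW = mat_adjoint_carrier[OF W]
  show 1: "mat_adjoint W * W = 1\<^sub>m n"
  proof (rule eq_matI)
    fix k l assume kl: "k < dim_row (1\<^sub>m n :: 'a mat)" "l < dim_col (1\<^sub>m n :: 'a mat)"
    then have "(mat_adjoint W * W) $$ (k, l) = (\<Sum>a<n. conjugate (V k a) * V l a)"
      using W aW by (simp add: scalar_prod_def W_def atLeast0LessThan)
    also have "\<dots> = (\<Sum>a<n. V l a * conjugate (V k a))" by (simp only: mult.commute)
    also have "\<dots> = 1\<^sub>m n $$ (k, l)"
      using orthonormal_systemsD[OF assms(1), of l k] kl by auto
    finally show "(mat_adjoint W * W) $$ (k, l) = 1\<^sub>m n $$ (k, l)" .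
  qed (use W aW in auto)
  show "W * mat_adjoint W = 1\<^sub>m n"
    by (rule mat_mult_left_right_inverse[OF aW W 1])
qed

text \<open>The singular values are recorded separately as reals \<open>\<sigma>\<close>, so that
  they are compared in the order of the reals and not in the scalar field.\<close>

definition is_svd :: "'f::real_or_complex mat \<Rightarrow> 'f mat \<Rightarrow> 'f mat \<Rightarrow> 'f mat \<Rightarrow> (nat \<Rightarrow> real) \<Rightarrow> bool" where
  "is_svd A U S V \<sigma> \<longleftrightarrow> (let m = dim_row A; p = dim_col A in
    U \<in> carrier_mat m m \<and> mat_adjoint U * U = 1\<^sub>m m \<and> U * mat_adjoint U = 1\<^sub>m m \<and>
    V \<in> carrier_mat p p \<and> mat_adjoint V * V = 1\<^sub>m p \<and> V * mat_adjoint V = 1\<^sub>m p \<and>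
    S \<in> carrier_mat m p \<and> A = U * S * mat_adjoint V \<and> diagonal_mat S \<and>
    (\<forall>i<min m p. S $$ (i, i) = of_real (\<sigma> i) \<and> 0 \<le> \<sigma> i) \<and>
    (\<forall>i. Suc i < min m p \<longrightarrow> \<sigma> (Suc i) \<le> \<sigma> i))"

text \<open>The columns form an orthonormal system. The bound does not depend on the matrix, so
  unitary factors chosen slice by slice are uniformly bounded.\<close>

lemma norm_entry_unitary_le:
  fixes U :: "'f::real_or_complex mat"
  assumes U: "U \<in> carrier_mat n n" "mat_adjoint U * U = 1\<^sub>m n" and ij: "i < n" "j < n"
  shows "norm (U $$ (i, j)) \<le> 1"
proof (rule norm_orthonormal_systems_le[of "\<lambda>k a. U $$ (a, k)"])
  have "(\<Sum>a<n. U $$ (a, k) * conjugate (U $$ (a, l))) = (mat_adjoint U * U) $$ (l, k)"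
    if "k < n" "l < n" for k l
    using that U(1) by (simp add: scalar_prod_def atLeast0LessThan mult.commute)
  then show "(\<lambda>k a. U $$ (a, k)) \<in> orthonormal_systems n"
    by (auto simp: orthonormal_systems_iff U(2))
qed (use ij in auto)

theorem svd_exists:
  fixes A :: "'f::real_or_complex mat"
  shows "\<exists>U S V \<sigma>. is_svd A U S V \<sigma>"
proof -
  define m where "m = dim_row A"
  define p where "p = dim_col A"
  have A: "A \<in> carrier_mat m p" by (simp add: m_def p_def)
  \<comment> \<open>The truncated subtraction makes the weights drop by 1 at each step down to
    0.\<close>
  define w where "w k = real (min m p - k)" for k
  \<comment> \<open>The weights vanish from \<open>min m p\<close> on, so the columns of index \<open>< m + p\<close> can be treated uniformly.\<close>
  define N where "N = m + p"
  \<comment> \<open>The sesquilinear form of \<open>A\<close>: evaluated at column \<open>i\<close>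
    of \<open>U\<close> and column \<open>j\<close> of \<open>V\<close> it is the entry
    \<open>(i, j)\<close> of the transformed matrix.\<close>
  define b where "b u v = (\<Sum>a<m. \<Sum>c<p. conjugate (u a) * A $$ (a, c) * v c)" for u v :: "nat \<Rightarrow> 'f"
  define f where "f U V = (\<Sum>k<N. w k * real_part (b (U k) (V k)))" for U V :: "nat \<Rightarrow> nat \<Rightarrow> 'f"
  have lin_right: "b u (\<lambda>a. \<alpha> * v a + \<beta> * v' a) = \<alpha> * b u v + \<beta> * b u v'" for \<alpha> \<beta> u v v'
    by (simp add: b_def sum.distrib sum_distrib_left algebra_simps)
  \<comment> \<open>The form is conjugate-linear in \<open>u\<close>; conjugating it gives a linear
    functional with the same real part, to which the rotation lemma applies.\<close>
  have lin_left: "conjugate (b (\<lambda>a. \<alpha> * u a + \<beta> * u' a) v)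
      = \<alpha> * conjugate (b u v) + \<beta> * conjugate (b u' v)" for \<alpha> \<beta> u u' v
    by (simp add: b_def sum.distrib sum_distrib_left algebra_simps sum_conjugate
        conjugate_dist_add conjugate_dist_mul)
  have lin_right': "b u (\<lambda>a. \<alpha> * v a) = \<alpha> * b u v" for \<alpha> u v
    using lin_right[of u \<alpha> v 0 v] by simp
  have "\<exists>U\<in>orthonormal_systems m. \<exists>V\<in>orthonormal_systems p.
    \<forall>U'\<in>orthonormal_systems m. \<forall>V'\<in>orthonormal_systems p. f U' V' \<le> f U V"
  proof (rule orthonormal_systems_attain_max)
    show "continuous_on UNIV (\<lambda>x. f (fst x) (snd x))"
      unfolding f_def b_def
      by (intro continuous_intros continuous_on_fst_entry continuous_on_snd_entry)
    fix U U' V V' :: "nat \<Rightarrow> nat \<Rightarrow> 'f"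
    assume eq: "\<And>k a. k < m \<Longrightarrow> a < m \<Longrightarrow> U k a = U' k a" "\<And>k a. k < p \<Longrightarrow> a < p \<Longrightarrow> V k a = V' k a"
    \<comment> \<open>From \<open>min m p\<close> on, a term may read vectors outside the systems,
      but its weight is 0.\<close>
    have "w k * real_part (b (U k) (V k)) = w k * real_part (b (U' k) (V' k))" for k
    proof (cases "k < min m p")
      case True
      then have "b (U k) (V k) = b (U' k) (V' k)"
        unfolding b_def by (intro sum.cong) (simp_all add: eq)
      then show ?thesis by simp
    next
      case False
      then have "w k = 0" by (auto simp: w_def)
      then show ?thesis by simp
    qed
    then show "f U V = f U' V'" unfolding f_def by (intro sum.cong refl)
  qed
  then obtain U V where UV: "U \<in> orthonormal_systems m" "V \<in> orthonormal_systems p"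
    and max: "\<And>U' V'. U' \<in> orthonormal_systems m \<Longrightarrow> V' \<in> orthonormal_systems p \<Longrightarrow> f U' V' \<le> f U V"
    by blast
  define B where "B i j = b (U i) (V j)" for i j
  have col: "of_real (w i) * B i j = of_real (w j) * conjugate (B j i)"
    if "i < p" "j < p" "i \<noteq> j" for i j
    unfolding B_def
    by (rule max_weighted_trace_offdiag[of V p i j N "\<lambda>k. b (U k)" w])
      (use UV that max[OF UV(1)] in \<open>auto simp: N_def lin_right f_def\<close>)
  have row: "of_real (w i) * conjugate (B j i) = of_real (w j) * B i j"
    if "i < m" "j < m" "i \<noteq> j" for i j
    unfolding B_def
    using max_weighted_trace_offdiag[of U m i j N "\<lambda>k u. conjugate (b u (V k))" w]
      UV that max[OF _ UV(2)] by (auto simp: N_def lin_left f_def)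
  have off: "B i j = 0" if "i < m" "j < p" "i \<noteq> j" for i j
  proof (cases "i < p \<and> j < m")
    case True
    \<comment> \<open>Combining the two relations eliminates \<open>B j i\<close> and leaves
      \<open>B i j\<close> times the difference of the squared weights, which are distinct.\<close>
    have "of_real (w i) * (of_real (w i) * B i j) = of_real (w i) * (of_real (w j) * conjugate (B j i))"
      using col[of i j] True that by simp
    also have "\<dots> = of_real (w j) * (of_real (w i) * conjugate (B j i))" by (simp only: mult.left_commute)
    also have "\<dots> = of_real (w j) * (of_real (w j) * B i j)"
      using row[of i j] True that by simp
    finally have "of_real (w i * w i - w j * w j) * B i j = 0"
      by (simp add: algebra_simps)
    moreover have "w i * w i \<noteq> w j * w j"
    proof -
      have "w i \<noteq> w j" using that True by (auto simp: w_def)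
      moreover have "0 \<le> w i" "0 \<le> w j" by (simp_all add: w_def)
      ultimately show ?thesis by (simp add: power2_eq_iff_nonneg flip: power2_eq_square)
    qed
    ultimately show ?thesis unfolding mult_eq_0_iff of_real_eq_0_iff by simp
  next
    case False
    \<comment> \<open>Outside the square block only one relation is available. There
      \<open>B j i\<close> refers to a vector beyond its system, but its coefficient is a vanishing
      weight, while the weight on \<open>B i j\<close> is positive.\<close>
    then have "i < p \<and> m \<le> j \<or> j < m \<and> p \<le> i" using that by auto
    then consider "i < p" "m \<le> j" | "j < m" "p \<le> i" by blast
    then show ?thesis
    proof cases
      case 1
      then have "w j = 0" "w i > 0" using that by (auto simp: w_def)
      then show ?thesis using col[of i j] 1 that by simp
    next
      case 2
      then have "w i = 0" "w j > 0" using that by (auto simp: w_def)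
      then show ?thesis using row[of i j] 2 that by simp
    qed
  qed
  have diag: "B i i = of_real (norm (B i i))" if "i < min m p" for i
    unfolding B_def
    by (rule max_weighted_trace_diag[of V p i N w "\<lambda>k. b (U k)"])
      (use UV that max[OF UV(1)] in \<open>auto simp: N_def w_def lin_right' f_def\<close>)
  have decr: "norm (B (Suc i) (Suc i)) \<le> norm (B i i)" if i: "Suc i < min m p" for i
  proof -
    define \<sigma> where "\<sigma> = id (i := Suc i, Suc i := i)"
    have "inj_on \<sigma> {..<n}" "\<sigma> ` {..<n} \<subseteq> {..<n}" if "Suc i < n" for n
      using that by (auto simp: \<sigma>_def inj_on_def split: if_splits)
    then have "(\<lambda>k. U (\<sigma> k)) \<in> orthonormal_systems m" "(\<lambda>k. V (\<sigma> k)) \<in> orthonormal_systems p"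
      using i UV by (auto intro!: orthonormal_systems_comp)
    note max' = max[OF this]
    have "i < N" "Suc i < N" using i by (simp_all add: N_def)
    have "(\<Sum>k\<in>{..<N} - {i, Suc i}. w k * real_part (B (\<sigma> k) (\<sigma> k)))
        = (\<Sum>k\<in>{..<N} - {i, Suc i}. w k * real_part (B k k))"
      by (rule sum.cong) (auto simp: \<sigma>_def)
    moreover have "\<sigma> i = Suc i" "\<sigma> (Suc i) = i" by (simp_all add: \<sigma>_def)
    ultimately have "w i * real_part (B (Suc i) (Suc i)) + w (Suc i) * real_part (B i i)
        \<le> w i * real_part (B i i) + w (Suc i) * real_part (B (Suc i) (Suc i))"
      using max' \<open>i < N\<close> \<open>Suc i < N\<close> unfolding f_def B_def[symmetric]
      by (simp add: sum_eq_two_plus_rest[of "{..<N}" i "Suc i"])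
    \<comment> \<open>With weights differing by 1, the inequality between the original and the
      swapped sums is exactly the comparison of the two diagonal entries.\<close>
    moreover have "w i = w (Suc i) + 1" using i by (simp add: w_def)
    ultimately have "real_part (B (Suc i) (Suc i)) \<le> real_part (B i i)" by (simp add: algebra_simps)
    then show ?thesis
      using diag[of i] diag[of "Suc i"] i by (metis Suc_lessD real_part_of_real)
  qed
  define UM where "UM = mat m m (\<lambda>(a, k). U k a)"
  define VM where "VM = mat p p (\<lambda>(a, k). V k a)"
  define S where "S = mat_adjoint UM * A * VM"
  have UM: "UM \<in> carrier_mat m m" and VM: "VM \<in> carrier_mat p p" by (simp_all add: UM_def VM_def)
  note aUM = mat_adjoint_carrier[OF UM] and aVM = mat_adjoint_carrier[OF VM]
  have uU: "mat_adjoint UM * UM = 1\<^sub>m m" "UM * mat_adjoint UM = 1\<^sub>m m"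
    unfolding UM_def by (rule mat_of_orthonormal_system[OF UV(1)])+
  have uV: "mat_adjoint VM * VM = 1\<^sub>m p" "VM * mat_adjoint VM = 1\<^sub>m p"
    unfolding VM_def by (rule mat_of_orthonormal_system[OF UV(2)])+
  have S: "S \<in> carrier_mat m p" unfolding S_def using aUM A VM by (metis mult_carrier_mat)
  have SB: "S $$ (i, j) = B i j" if "i < m" "j < p" for i j
  proof -
    have "S $$ (i, j) = (\<Sum>c<p. (\<Sum>a<m. conjugate (U i a) * A $$ (a, c)) * V j c)"
      using that A aUM unfolding S_def
      by (simp add: scalar_prod_def UM_def VM_def atLeast0LessThan)
    also have "\<dots> = (\<Sum>c<p. \<Sum>a<m. conjugate (U i a) * A $$ (a, c) * V j c)"
      by (simp add: sum_distrib_right)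
    also have "\<dots> = B i j" unfolding B_def b_def by (rule sum.swap)
    finally show ?thesis .
  qed
  have "UM * S = UM * mat_adjoint UM * (A * VM)"
    unfolding S_def assoc_mult_mat[OF aUM A VM]
    by (rule assoc_mult_mat[OF UM aUM mult_carrier_mat[OF A VM], symmetric])
  also have "\<dots> = A * VM" unfolding uU by (rule left_mult_one_mat[OF mult_carrier_mat[OF A VM]])
  finally have "UM * S * mat_adjoint VM = A * (VM * mat_adjoint VM)"
    by (simp only: assoc_mult_mat[OF A VM aVM])
  then have "A = UM * S * mat_adjoint VM" using A by (simp add: uV)
  moreover have "diagonal_mat S" using S SB off by (auto simp: diagonal_mat_def)
  moreover have "S $$ (i, i) = of_real (norm (B i i))" if "i < min m p" for i
    using that SB diag[OF that] by simp
  ultimately have "is_svd A UM S VM (\<lambda>i. norm (B i i))"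
    using UM uU VM uV S decr unfolding is_svd_def Let_def m_def[symmetric] p_def[symmetric] by simp
  then show ?thesis by blast
qed

subsection \<open>Quasitubes as multipliers of the Fourier coefficients\<close>

context quasitubal
begin

section \<open>Geometry of the inner product and Fourier coefficients\<close>

lemma ip_add_right: "ip x (y + z) = ip x y + ip x z"
  by (simp only: ip_commute[of x] ip_add_left conjugate_dist_add)

lemma ip_scale_right: "ip x (scale c y) = conjugate c * ip x y"
  by (simp only: ip_commute[of x] ip_scale_left conjugate_dist_mul)

lemma ip_zero_left [simp]: "ip 0 y = 0"
  using ip_scale_left[of 0 0 y] by simp

lemma ip_zero_right [simp]: "ip x 0 = 0"
  using ip_scale_right[of x 0 0] by simp

lemma ip_diff_left: "ip (x - y) z = ip x z - ip y z"
  using ip_add_left[of "x - y" y z] by simp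

lemma ip_diff_right: "ip x (y - z) = ip x y - ip x z"
  using ip_add_right[of x "y - z" z] by simp

lemma ip_sum_left: "ip (\<Sum>j\<in>F. f j) z = (\<Sum>j\<in>F. ip (f j) z)"
  by (induction F rule: infinite_finite_induct) (simp_all add: ip_add_left)

lemma norm_eq_of_ip:
  assumes "ip x x = of_real r"
  shows "(norm x)\<^sup>2 = r"
  using assms unfolding ip_self of_real_eq_iff .

lemma norm_basis [simp]: "norm (\<phi> j) = 1"
proof -
  have "(norm (\<phi> j))\<^sup>2 = 1"
    by (rule norm_eq_of_ip) (simp add: orthonormal)
  then show ?thesis using norm_ge_zero[of "\<phi> j"] unfolding power2_eq_1_iff by linarith
qed

text \<open>Cauchy-Schwarz: subtract from \<open>x\<close> its projection \<open>scale c y\<close>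
  and use that the squared norm of the rest is nonnegative.\<close>

lemma norm_ip_le: "norm (ip x y) \<le> norm x * norm y"
proof (cases "y = 0")
  case False
  define n where "n = (norm y)\<^sup>2"
  define t where "t = ip x y"
  define c where "c = t / of_real n"
  have n: "n > 0" using False by (simp add: n_def)
  have cn: "c * of_real n = t" "conjugate c * of_real n = conjugate t"
    using n conjugate_dist_mul[of c "of_real n"] by (simp_all add: c_def)
  have "ip (x - scale c y) (x - scale c y)
      = ip x x - conjugate c * t - c * (conjugate t - conjugate c * of_real n)"
    by (simp only: ip_diff_left ip_diff_right ip_scale_left ip_scale_right t_def n_def
        ip_self[of y] ip_commute[of y x]) (simp add: algebra_simps)
  also have "\<dots> = ip x x - conjugate c * t" by (simp add: cn)
  finally have "ip (x - scale c y) (x - scale c y) = ip x x - conjugate c * t" .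
  moreover have "conjugate c * t = of_real ((norm t)\<^sup>2 / n)"
  proof -
    have "of_real n * (conjugate c * t) = conjugate t * t"
      by (simp only: cn(2)[symmetric] mult.assoc mult.left_commute mult.commute)
    then have "of_real n * (conjugate c * t) = of_real n * of_real ((norm t)\<^sup>2 / n)"
      using n by (simp add: conjugate_mult_of_real)
    then show ?thesis using n unfolding mult_cancel_left by simp
  qed
  ultimately have "ip (x - scale c y) (x - scale c y) = of_real ((norm x)\<^sup>2 - (norm t)\<^sup>2 / n)"
    by (simp only: ip_self[of x] of_real_diff)
  then have "(norm (x - scale c y))\<^sup>2 = (norm x)\<^sup>2 - (norm t)\<^sup>2 / n"
    by (rule norm_eq_of_ip)
  then have "(norm t)\<^sup>2 / n \<le> (norm x)\<^sup>2"
    using zero_le_power2[of "norm (x - scale c y)"] by linarith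
  then have "(norm t)\<^sup>2 \<le> (norm x * norm y)\<^sup>2"
    using n by (simp add: pos_divide_le_eq power_mult_distrib n_def)
  then show ?thesis unfolding t_def by (rule power2_le_imp_le) simp
qed simp

lemma bounded_linear_ip: "bounded_linear (\<lambda>x. ip x y)"
proof (rule bounded_linear_intro[where K = "norm y"])
  show "ip (r *\<^sub>R x) y = r *\<^sub>R ip x y" for r x
    by (simp add: scale_of_real[symmetric] ip_scale_left scaleR_conv_of_real)
qed (simp_all add: ip_add_left norm_ip_le)

lemma coef_add [simp]: "coef (x + y) j = coef x j + coef y j"
  by (simp add: coef_def ip_add_left)

lemma coef_diff [simp]: "coef (x - y) j = coef x j - coef y j"
  by (simp add: coef_def ip_diff_left)

lemma coef_scale [simp]: "coef (scale c x) j = c * coef x j"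
  by (simp add: coef_def ip_scale_left)

lemma coef_zero [simp]: "coef 0 j = 0"
  by (simp add: coef_def)

lemma coef_basis: "coef (\<phi> i) j = (if i = j then 1 else 0)"
  by (simp add: coef_def orthonormal)

lemma norm_coef_le: "norm (coef x j) \<le> norm x"
  using norm_ip_le[of x "\<phi> j"] by (simp add: coef_def)

text \<open>The vectors orthogonal to the difference \<open>z\<close> form a closed set containing
  the dense span, so \<open>z\<close> is orthogonal to itself. Identities between operators thereby
  reduce to identities between scalars.\<close>

lemma coef_eqI:
  assumes "\<And>j. coef x j = coef y j"
  shows "x = y"
proof -
  define z where "z = x - y"
  have z: "ip z (\<phi> j) = 0" for j using assms[of j] by (simp add: z_def coef_def ip_diff_left)
  have "ip v z = 0" if "v \<in> span (range \<phi>)" for v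
    using that
  proof (induction rule: span_induct_alt)
    case (step c x y)
    then obtain j where "x = \<phi> j" by auto
    have "ip (\<phi> j) z = conjugate (ip z (\<phi> j))" by (rule ip_commute)
    then have "ip x z = 0" using \<open>x = \<phi> j\<close> z by simp
    then show ?case using step by (simp add: ip_add_left ip_scale_left)
  qed simp
  then have "span (range \<phi>) \<subseteq> {v. ip v z = 0}" by auto
  moreover have "closed {v. ip v z = 0}"
    by (intro closed_Collect_eq continuous_on_const
        bounded_linear.continuous_on[OF bounded_linear_ip continuous_on_id])
  ultimately have "z \<in> {v. ip v z = 0}"
    using closure_minimal dense_span by blast
  then have "(norm z)\<^sup>2 = 0" by (intro norm_eq_of_ip) simp
  then show ?thesis by (simp add: z_def)
qed

section \<open>Finite Fourier sums, Bessel's inequality and convergence\<close>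

lemma coef_finite_sum:
  assumes "finite F"
  shows "coef (\<Sum>j\<in>F. scale (c j) (\<phi> j)) k = (if k \<in> F then c k else 0)"
proof -
  have "coef (\<Sum>j\<in>F. scale (c j) (\<phi> j)) k = (\<Sum>j\<in>F. if j = k then c j else 0)"
    unfolding coef_def ip_sum_left
    by (rule sum.cong) (simp_all add: ip_scale_left orthonormal)
  then show ?thesis using assms by simp
qed

lemma ip_finite_sum:
  "ip (\<Sum>j\<in>F. scale (c j) (\<phi> j)) y = (\<Sum>j\<in>F. c j * conjugate (coef y j))"
  unfolding ip_sum_left coef_def
  by (rule sum.cong) (simp_all only: ip_scale_left ip_commute[of y "\<phi> _"] conjugate_id)

lemma norm_finite_sum:
  assumes "finite F"
  shows "(norm (\<Sum>j\<in>F. scale (c j) (\<phi> j)))\<^sup>2 = (\<Sum>j\<in>F. (norm (c j))\<^sup>2)"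
proof (rule norm_eq_of_ip)
  show "ip (\<Sum>j\<in>F. scale (c j) (\<phi> j)) (\<Sum>j\<in>F. scale (c j) (\<phi> j))
      = of_real (\<Sum>j\<in>F. (norm (c j))\<^sup>2)"
    unfolding ip_finite_sum of_real_sum
    by (rule sum.cong) (simp_all add: coef_finite_sum assms mult_conjugate_of_real)
qed

text \<open>The squared distance from \<open>x\<close> to its partial Fourier sum is the difference
  of the two sides.\<close>

lemma bessel:
  assumes "finite F"
  shows "(\<Sum>j\<in>F. (norm (coef x j))\<^sup>2) \<le> (norm x)\<^sup>2"
proof -
  define s where "s = (\<Sum>j\<in>F. (norm (coef x j))\<^sup>2)"
  define y where "y = (\<Sum>j\<in>F. scale (coef x j) (\<phi> j))"
  have yx: "ip y x = of_real s"
    unfolding y_def s_def ip_finite_sum by (simp only: mult_conjugate_of_real of_real_sum)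
  have "ip x y = conjugate (ip y x)" by (rule ip_commute)
  then have xy: "ip x y = of_real s" by (simp add: yx)
  have "(norm y)\<^sup>2 = s" unfolding y_def s_def by (rule norm_finite_sum[OF assms])
  moreover have "ip (x - y) (x - y) = ip x x - ip y x - (ip x y - ip y y)"
    by (simp only: ip_diff_left ip_diff_right)
  ultimately have "ip (x - y) (x - y) = of_real ((norm x)\<^sup>2 - s)"
    unfolding xy yx ip_self[of x] ip_self[of y] by (simp del: of_real_power)
  then have "(norm (x - y))\<^sup>2 = (norm x)\<^sup>2 - s" by (rule norm_eq_of_ip)
  then show ?thesis using zero_le_power2[of "norm (x - y)"] unfolding s_def by linarith
qed

text \<open>The existence half of Riesz-Fischer: enlarging a finite partial sum moves it by a vector
  whose squared norm is a partial sum of the squared coefficients, so the net of finite sums is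
  Cauchy, and the space is complete.\<close>

lemma summable_basis:
  assumes bound: "\<And>F. finite F \<Longrightarrow> (\<Sum>j\<in>F. (norm (c j))\<^sup>2) \<le> K"
  shows "(\<lambda>j. scale (c j) (\<phi> j)) summable_on UNIV"
proof -
  define f where "f j = scale (c j) (\<phi> j)" for j
  define n where "n j = (norm (c j))\<^sup>2" for j
  have "n summable_on UNIV"
    by (rule nonneg_bdd_above_summable_on) (auto simp: n_def intro!: bdd_aboveI[of _ K] bound)
  then obtain s where s: "(n has_sum s) UNIV" by (auto simp: summable_on_def)
  have le: "sum n X \<le> s" if "finite X" for X
    by (rule finite_sum_le_has_sum[OF s that]) (auto simp: n_def)
  have "cauchy_filter (filtermap (sum f) (finite_subsets_at_top UNIV))"
    unfolding cauchy_filter_metric_filtermap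
  proof (intro allI impI)
    fix e :: real assume "e > 0"
    have "(sum n \<longlongrightarrow> s) (finite_subsets_at_top UNIV)" using s by (simp add: has_sum_def)
    then have "eventually (\<lambda>X. dist (sum n X) s < (e / 2)\<^sup>2) (finite_subsets_at_top UNIV)"
      using \<open>e > 0\<close> by (intro tendstoD) auto
    then obtain F where F: "finite F" "dist (sum n F) s < (e / 2)\<^sup>2"
      unfolding eventually_finite_subsets_at_top by auto
    \<comment> \<open>Only sets containing \<open>F\<close> are compared with \<open>F\<close>,
      since then the difference is a sum over \<open>X - F\<close>; two such sets are compared
      through \<open>F\<close>.\<close>
    have close: "dist (sum f X) (sum f F) < e / 2" if "finite X" "F \<subseteq> X" for X
    proof -
      have "sum f X - sum f F = sum f (X - F)" "sum n X - sum n F = sum n (X - F)"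
        using that F by (simp_all add: sum_diff)
      then have "(dist (sum f X) (sum f F))\<^sup>2 = sum n X - sum n F"
        using that norm_finite_sum[of "X - F" c] by (simp add: dist_norm f_def n_def)
      also have "\<dots> < (e / 2)\<^sup>2" using le[OF that(1)] F(2) by (simp add: dist_real_def)
      finally show ?thesis by (rule power2_less_imp_less) (use \<open>e > 0\<close> in simp)
    qed
    show "\<exists>P. eventually P (finite_subsets_at_top UNIV) \<and>
        (\<forall>x y. P x \<and> P y \<longrightarrow> dist (sum f x) (sum f y) < e)"
    proof (intro exI conjI allI impI)
      show "eventually (\<lambda>X. finite X \<and> F \<subseteq> X) (finite_subsets_at_top UNIV)"
        unfolding eventually_finite_subsets_at_top using F by auto
      fix X Y assume "(finite X \<and> F \<subseteq> X) \<and> finite Y \<and> F \<subseteq> Y"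
      then show "dist (sum f X) (sum f Y) < e"
        using close[of X] close[of Y] by (metis dist_triangle_half_l)
    qed
  qed
  moreover have "complete (UNIV :: 'h set)"
    by (rule completeI) (auto intro: Cauchy_convergent simp: convergent_def[symmetric])
  ultimately obtain L where "(sum f \<longlongrightarrow> L) (finite_subsets_at_top UNIV)"
    using complete_uniform[where S = UNIV] by (force simp add: filterlim_def)
  then show ?thesis
    unfolding f_def[symmetric] summable_on_def has_sum_def by blast
qed

lemma coef_has_sum:
  assumes "((\<lambda>j. scale (c j) (\<phi> j)) has_sum y) UNIV"
  shows "coef y k = c k"
proof -
  have "((\<lambda>j. ip (scale (c j) (\<phi> j)) (\<phi> k)) has_sum ip y (\<phi> k)) UNIV"
    by (rule has_sum_bounded_linear[OF bounded_linear_ip assms])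
  moreover have "((\<lambda>j. ip (scale (c j) (\<phi> j)) (\<phi> k)) has_sum c k) UNIV"
    by (rule has_sum_finite_neutralI[of "{k}"]) (auto simp: ip_scale_left orthonormal)
  ultimately show ?thesis unfolding coef_def by (rule has_sum_unique)
qed

section \<open>Multiplier operators and their identification with quasitubes\<close>

text \<open>The diagonal operator with symbol \<open>c\<close>, which inverts \<open>pi_map\<close>
  on bounded sequences. The infinite sum defaults to 0 where it does not converge, hence the
  boundedness hypotheses below.\<close>

definition multiplier :: "(int \<Rightarrow> 'f) \<Rightarrow> 'h \<Rightarrow> 'h" where
  "multiplier c x = (\<Sum>\<^sub>\<infinity>j\<in>UNIV. scale (c j * coef x j) (\<phi> j))"

lemma multiplier_partial_sum_le:
  assumes "\<And>j. norm (c j) \<le> K" "finite F"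
  shows "(\<Sum>j\<in>F. (norm (c j * coef x j))\<^sup>2) \<le> (K * norm x)\<^sup>2"
proof -
  have "(\<Sum>j\<in>F. (norm (c j * coef x j))\<^sup>2) \<le> (\<Sum>j\<in>F. K\<^sup>2 * (norm (coef x j))\<^sup>2)"
    using assms(1)
    by (intro sum_mono) (simp add: norm_mult power_mult_distrib mult_right_mono power_mono)
  also have "\<dots> \<le> K\<^sup>2 * (norm x)\<^sup>2"
    unfolding sum_distrib_left[symmetric] by (intro mult_left_mono bessel assms(2)) simp
  finally show ?thesis by (simp add: power_mult_distrib)
qed

lemma multiplier_has_sum:
  assumes "bounded (range c)"
  shows "((\<lambda>j. scale (c j * coef x j) (\<phi> j)) has_sum multiplier c x) UNIV"
proof -
  obtain K where "\<And>j. norm (c j) \<le> K" using assms by (auto simp: bounded_iff)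
  then show ?thesis
    unfolding multiplier_def
    by (intro has_sum_infsum summable_basis[OF multiplier_partial_sum_le])
qed

lemma coef_multiplier [simp]:
  assumes "bounded (range c)"
  shows "coef (multiplier c x) j = c j * coef x j"
  by (rule coef_has_sum[OF multiplier_has_sum[OF assms]])

lemma norm_multiplier_le:
  assumes "\<And>j. norm (c j) \<le> K"
  shows "norm (multiplier c x) \<le> K * norm x"
proof -
  have "0 \<le> K" using assms[of 0] norm_ge_zero order_trans by blast
  have "bounded (range c)" using assms by (auto simp: bounded_iff)
  from multiplier_has_sum[OF this, of x]
  have "(sum (\<lambda>j. scale (c j * coef x j) (\<phi> j)) \<longlongrightarrow> multiplier c x) (finite_subsets_at_top UNIV)"
    by (simp add: has_sum_def)
  then show ?thesis
  proof (rule Lim_norm_ubound[rotated])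
    show "\<forall>\<^sub>F F in finite_subsets_at_top UNIV.
        norm (\<Sum>j\<in>F. scale (c j * coef x j) (\<phi> j)) \<le> K * norm x"
    proof (rule eventually_finite_subsets_at_top_weakI)
      fix F :: "int set" assume "finite F"
      then have "(norm (\<Sum>j\<in>F. scale (c j * coef x j) (\<phi> j)))\<^sup>2 \<le> (K * norm x)\<^sup>2"
        unfolding norm_finite_sum[OF \<open>finite F\<close>] by (rule multiplier_partial_sum_le[OF assms])
      then show "norm (\<Sum>j\<in>F. scale (c j * coef x j) (\<phi> j)) \<le> K * norm x"
        by (rule power2_le_imp_le) (simp add: \<open>0 \<le> K\<close>)
    qed
  qed simp
qed

lemma bounded_coef: "bounded (range (coef x))"
  using norm_coef_le by (auto simp: bounded_iff)

lemma coef_star [simp]: "coef (star x y) j = coef x j * coef y j"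
proof -
  have "star x y = multiplier (coef x) y" by (simp add: star_def multiplier_def)
  then show ?thesis by (simp add: bounded_coef)
qed

lemma multiplier_quasitube:
  assumes "bounded (range c)"
  shows "multiplier c \<in> quasitubes"
proof -
  have "H_linear (multiplier c)"
    unfolding H_linear_def
    by (intro allI coef_eqI) (simp add: assms algebra_simps)
  moreover obtain K where K: "\<And>j. norm (c j) \<le> K" using assms by (auto simp: bounded_iff)
  have "\<exists>K. \<forall>x. norm (multiplier c x) \<le> K * norm x"
    using norm_multiplier_le[OF K] by (intro exI allI)
  ultimately show ?thesis by (simp add: quasitubes_def)
qed

lemma pi_map_multiplier:
  assumes "bounded (range c)"
  shows "pi_map (multiplier c) j = c j"
  using coef_multiplier[OF assms, of "\<phi> j" j] by (simp add: pi_map_def coef_def orthonormal)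

text \<open>The vector \<open>scale (coef x j) (\<phi> j)\<close> is both
  \<open>star (\<phi> j) x\<close> and its own \<open>star\<close> product with
  \<open>\<phi> j\<close>. Pulling the first factor out of \<open>q\<close> in both forms and
  comparing the coefficients at \<open>j\<close> gives the claim.\<close>

lemma coef_quasitube:
  assumes "q \<in> quasitubes"
  shows "coef (q x) j = pi_map q j * coef x j"
proof -
  have star: "q (star a x) = star a (q x)" for a x
  proof -
    \<comment> \<open>\<open>H_linear\<close> speaks of sums of two products, so a vanishing second
      product is added.\<close>
    have "star a x = star a x + star 0 0" "star a (q x) = star a (q x) + star 0 (q 0)"
      by (auto intro!: coef_eqI)
    moreover have "q (star a x + star 0 0) = star a (q x) + star 0 (q 0)"
      using assms by (simp add: quasitubes_def H_linear_def)
    ultimately show ?thesis by (simp only:)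
  qed
  have "scale (coef x j) (\<phi> j) = star (\<phi> j) x"
    by (rule coef_eqI) (simp add: coef_basis)
  then have "q (scale (coef x j) (\<phi> j)) = star (\<phi> j) (q x)" using star by simp
  moreover have "scale (coef x j) (\<phi> j) = star (scale (coef x j) (\<phi> j)) (\<phi> j)"
    by (rule coef_eqI) (simp add: coef_basis)
  then have "q (scale (coef x j) (\<phi> j)) = star (scale (coef x j) (\<phi> j)) (q (\<phi> j))"
    using star[of "scale (coef x j) (\<phi> j)" "\<phi> j"] by (simp only:)
  ultimately have "coef (star (\<phi> j) (q x)) j = coef (star (scale (coef x j) (\<phi> j)) (q (\<phi> j))) j"
    by simp
  then show ?thesis by (simp add: coef_basis) (simp add: pi_map_def coef_def)
qed

lemma quasitube_eqI:
  assumes "q \<in> quasitubes" "r \<in> quasitubes" "\<And>j. pi_map q j = pi_map r j"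
  shows "q = r"
  by (intro ext coef_eqI) (simp add: coef_quasitube assms)

lemma bounded_pi_map:
  assumes "q \<in> quasitubes"
  shows "bounded (range (pi_map q))"
proof -
  obtain K where K: "\<And>x. norm (q x) \<le> K * norm x" using assms by (auto simp: quasitubes_def)
  have "norm (pi_map q j) \<le> K" for j
    using norm_ip_le[of "q (\<phi> j)" "\<phi> j"] K[of "\<phi> j"] by (simp add: pi_map_def)
  then show ?thesis by (auto simp: bounded_iff)
qed

section \<open>Adjoint, spectrum and order\<close>

text \<open>Both inner products are the sum of the same Parseval series, the symbol being fixed by
  conjugation.\<close>

lemma multiplier_symmetric:
  assumes "bounded (range c)" "\<And>j. conjugate (c j) = c j"
  shows "ip (multiplier c x) y = ip x (multiplier c y)"
proof -
  have sum: "((\<lambda>j. c j * (coef x j * conjugate (coef y j))) has_sum ip (multiplier c x) y) UNIV" for x y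
    using has_sum_bounded_linear[OF bounded_linear_ip multiplier_has_sum[OF assms(1)], of x y]
    by (simp add: ip_scale_left coef_def ip_commute[of y "\<phi> _"] mult.assoc)
  have "ip x (multiplier c y) = conjugate (ip (multiplier c y) x)"
    by (rule ip_commute)
  moreover have "((\<lambda>j. conjugate (c j * (coef y j * conjugate (coef x j))))
      has_sum conjugate (ip (multiplier c y) x)) UNIV"
    by (rule has_sum_bounded_linear[OF bounded_linear_conjugate sum])
  ultimately have "((\<lambda>j. c j * (coef x j * conjugate (coef y j))) has_sum ip x (multiplier c y)) UNIV"
    by (simp add: conjugate_dist_mul assms(2) mult.commute)
  with sum show ?thesis by (rule has_sum_unique)
qed

lemma hadjoint_multiplier:
  assumes "bounded (range c)" "\<And>j. conjugate (c j) = c j"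
  shows "hadjoint (multiplier c) = multiplier c"
  unfolding hadjoint_def
proof (rule the_equality)
  show "\<forall>x y. ip (multiplier c x) y = ip x (multiplier c y)"
    using multiplier_symmetric[OF assms] by blast
  fix r assume r: "\<forall>x y. ip (multiplier c x) y = ip x (r y)"
  show "r = multiplier c"
  proof
    fix y
    have "ip z (r y - multiplier c y) = 0" for z
      using r multiplier_symmetric[OF assms] by (simp add: ip_diff_right)
    then have "(norm (r y - multiplier c y))\<^sup>2 = 0" by (intro norm_eq_of_ip) simp
    then show "r y = multiplier c y" by simp
  qed
qed

text \<open>A scalar \<open>a\<close> off the closed half-line has a positive distance
  \<open>d\<close> from it, hence from all \<open>c j\<close>. The inverses of
  \<open>c j - a\<close> are then bounded by \<open>inverse d\<close>, and their multiplier inverts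
  the shifted operator.\<close>

lemma qnonneg_multiplier:
  assumes bdd: "bounded (range c)" and c: "\<And>j. c j = of_real (r j)" "\<And>j. 0 \<le> r j"
  shows "qnonneg (multiplier c)"
  unfolding qnonneg_def
proof (intro conjI)
  show "multiplier c \<in> quasitubes" by (rule multiplier_quasitube[OF bdd])
  show "multiplier c = hadjoint (multiplier c)"
    by (rule hadjoint_multiplier[symmetric, OF bdd]) (simp add: c(1))
  have "qinvertible (\<lambda>x. multiplier c x - scale a x)" if a: "a \<notin> of_real ` {0..}" for a
  proof -
    have "of_real ` {0..} = {x :: 'f. of_real (real_part x) = x} \<inter> {x. 0 \<le> real_part x}"
      by (force simp: image_iff)
    also have "closed \<dots>"
      by (intro closed_Int closed_Collect_eq closed_Collect_le continuous_intros)
    finally have "open (- of_real ` {0..} :: 'f set)" by (simp only: open_Compl)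
    then obtain d where d: "d > 0" "ball a d \<subseteq> - of_real ` {0..}"
      using a unfolding open_contains_ball by blast
    define e where "e j = inverse (c j - a)" for j
    have ne: "c j \<noteq> a" for j using a c[of j] by auto
    have "d \<le> norm (c j - a)" for j
    proof (rule ccontr)
      assume "\<not> d \<le> norm (c j - a)"
      then have "c j \<in> ball a d" by (simp add: dist_norm norm_minus_commute)
      then show False using d(2) c[of j] by auto
    qed
    then have "norm (e j) \<le> inverse d" for j
      unfolding e_def norm_inverse using d(1) by (intro le_imp_inverse_le)
    then have e: "bounded (range e)" by (auto simp: bounded_iff)
    show ?thesis
      unfolding qinvertible_def
    proof (intro bexI conjI)
      show "multiplier e \<in> quasitubes" by (rule multiplier_quasitube[OF e])
      have "e j * (c j * b - a * b) = b" "c j * (e j * b) - a * (e j * b) = b" for j b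
        using ne[of j] by (simp_all add: e_def flip: left_diff_distrib mult.assoc)
      then show "multiplier e \<circ> (\<lambda>x. multiplier c x - scale a x) = id"
        "(\<lambda>x. multiplier c x - scale a x) \<circ> multiplier e = id"
        by (auto intro!: ext coef_eqI simp: bdd e)
    qed
  qed
  then show "qspectrum (multiplier c) \<subseteq> of_real ` {0..}"
    unfolding qspectrum_def by blast
qed

lemma qgeq_multiplier:
  assumes "bounded (range c)" "bounded (range d)"
    and "\<And>j. c j = of_real (r j)" "\<And>j. d j = of_real (s j)" "\<And>j. s j \<le> r j"
  shows "qgeq (multiplier c) (multiplier d)"
proof -
  have bdd: "bounded (range (\<lambda>j. c j - d j))"
    by (rule bounded_minus_comp) (fact assms)+
  have "(\<lambda>x. multiplier c x - multiplier d x) = multiplier (\<lambda>j. c j - d j)"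
    by (intro ext coef_eqI) (simp add: assms(1,2) bdd left_diff_distrib)
  then show ?thesis
    unfolding qgeq_def using qnonneg_multiplier[OF bdd, of "\<lambda>j. r j - s j"] assms by simp
qed

lemma multiplier_const_zero: "multiplier (\<lambda>_. 0) = (\<lambda>x. 0)"
  by (intro ext coef_eqI) simp

lemma multiplier_const_one: "multiplier (\<lambda>_. 1) = id"
  by (intro ext coef_eqI) simp

end

subsection \<open>Quasitubal tensors\<close>

lemma index_mult_mat_sum:
  assumes "A \<in> carrier_mat m n" "B \<in> carrier_mat n p" "i < m" "j < p"
  shows "(A * B) $$ (i, j) = (\<Sum>l<n. A $$ (i, l) * B $$ (l, j))"
  using assms by (simp add: scalar_prod_def atLeast0LessThan)

definition bounded_mats :: "nat \<Rightarrow> nat \<Rightarrow> (int \<Rightarrow> 'f::real_normed_field mat) set" where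
  "bounded_mats m p = {M. (\<forall>k. M k \<in> carrier_mat m p) \<and>
    (\<forall>i<m. \<forall>j<p. bounded (range (\<lambda>k. M k $$ (i, j))))}"

lemma bounded_sum_comp:
  fixes f :: "'a \<Rightarrow> 'b \<Rightarrow> 'c::real_normed_vector"
  assumes "\<And>l. l \<in> A \<Longrightarrow> bounded (f l ` S)"
  shows "bounded ((\<lambda>k. \<Sum>l\<in>A. f l k) ` S)"
  using assms
proof (induction A rule: infinite_finite_induct)
  case (insert a A)
  then show ?case using bounded_plus_comp[of "f a" S "\<lambda>k. \<Sum>l\<in>A. f l k"] by simp
qed (auto simp: image_constant_conv)

lemma bounded_mult_range:
  fixes f g :: "'a \<Rightarrow> 'b::real_normed_algebra"
  assumes "bounded (range f)" "bounded (range g)"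
  shows "bounded (range (\<lambda>k. f k * g k))"
proof -
  obtain K L where K: "\<And>k. norm (f k) \<le> K" and L: "\<And>k. norm (g k) \<le> L"
    using assms by (auto simp: bounded_iff)
  have "norm (f k * g k) \<le> K * L" for k
    by (rule order_trans[OF norm_mult_ineq mult_mono'[OF K L]]) auto
  then show ?thesis by (auto simp: bounded_iff)
qed

lemma bounded_mats_mult:
  assumes "M \<in> bounded_mats m n" "N \<in> bounded_mats n p"
  shows "(\<lambda>k. M k * N k) \<in> bounded_mats m p"
proof -
  have M: "M k \<in> carrier_mat m n" "N k \<in> carrier_mat n p" for k
    using assms by (simp_all add: bounded_mats_def)
  have "bounded (range (\<lambda>k. \<Sum>l<n. M k $$ (i, l) * N k $$ (l, j)))" if "i < m" "j < p" for i j
    using assms that by (intro bounded_sum_comp bounded_mult_range) (auto simp: bounded_mats_def)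
  then show ?thesis
    using mult_carrier_mat[OF M] by (simp add: bounded_mats_def index_mult_mat_sum[OF M])
qed

lemma bounded_mats_adjoint:
  fixes M :: "int \<Rightarrow> 'f::real_or_complex mat"
  assumes "M \<in> bounded_mats m p"
  shows "(\<lambda>k. mat_adjoint (M k)) \<in> bounded_mats p m"
proof -
  have M: "M k \<in> carrier_mat m p" for k
    using assms by (simp add: bounded_mats_def)
  have "bounded (range (\<lambda>k. conjugate (M k $$ (j, i))))" if "i < p" "j < m" for i j
    using assms that by (simp add: bounded_mats_def bounded_iff)
  moreover have "dim_row (M k) = m" "dim_col (M k) = p" for k
    using M[of k] by auto
  ultimately show ?thesis using mat_adjoint_carrier[OF M] by (simp add: bounded_mats_def)
qed

lemma bounded_mats_norm_le:
  assumes "\<And>k. M k \<in> carrier_mat m p" "\<And>k i j. i < m \<Longrightarrow> j < p \<Longrightarrow> norm (M k $$ (i, j)) \<le> K"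
  shows "M \<in> bounded_mats m p"
proof -
  have "bounded (range (\<lambda>k. M k $$ (i, j)))" if "i < m" "j < p" for i j
    using assms(2)[OF that] by (intro boundedI[of _ K]) auto
  then show ?thesis using assms(1) by (simp add: bounded_mats_def)
qed

context quasitubal
begin

section \<open>Tensors as bounded families of slices\<close>

text \<open>The inverse of \<open>slice\<close> on bounded families; through it the tensor
  operations become operations on each slice.\<close>

definition tensor_of :: "nat \<Rightarrow> nat \<Rightarrow> (int \<Rightarrow> 'f mat) \<Rightarrow> ('h \<Rightarrow> 'h) mat" where
  "tensor_of m p M = mat m p (\<lambda>(i, j). multiplier (\<lambda>k. M k $$ (i, j)))"

lemma slice_bounded_mats:
  assumes "X \<in> tensors m p"
  shows "slice X \<in> bounded_mats m p"
  using assms by (auto simp: bounded_mats_def tensors_def slice_def bounded_pi_map)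

lemma tensor_of_tensors:
  assumes "M \<in> bounded_mats m p"
  shows "tensor_of m p M \<in> tensors m p"
  using assms by (auto simp: tensors_def tensor_of_def bounded_mats_def multiplier_quasitube)

lemma slice_tensor_of:
  assumes "M \<in> bounded_mats m p"
  shows "slice (tensor_of m p M) k = M k"
proof -
  have "M k \<in> carrier_mat m p" using assms by (simp add: bounded_mats_def)
  then show ?thesis
    using assms
    by (intro eq_matI) (auto simp: slice_def tensor_of_def bounded_mats_def pi_map_multiplier)
qed

lemma tensor_eqI:
  assumes "X \<in> tensors m p" "Y \<in> tensors m p" "\<And>k. slice X k = slice Y k"
  shows "X = Y"
proof (rule eq_matI)
  have dims: "dim_row X = m" "dim_col X = p" "dim_row Y = m" "dim_col Y = p"
    using assms(1,2) by (auto simp: tensors_def)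
  show "dim_row X = dim_row Y" "dim_col X = dim_col Y" by (simp_all add: dims)
  fix i j assume "i < dim_row Y" "j < dim_col Y"
  then have ij: "i < m" "j < p" by (simp_all add: dims)
  have "pi_map (X $$ (i, j)) k = slice X k $$ (i, j)" "pi_map (Y $$ (i, j)) k = slice Y k $$ (i, j)" for k
    using ij dims by (simp_all add: slice_def)
  then have "pi_map (X $$ (i, j)) k = pi_map (Y $$ (i, j)) k" for k
    using assms(3) by simp
  then show "X $$ (i, j) = Y $$ (i, j)"
    using assms(1,2) ij by (intro quasitube_eqI) (auto simp: tensors_def)
qed

lemma tensor_of_slice:
  assumes "X \<in> tensors m p"
  shows "tensor_of m p (slice X) = X"
  using slice_bounded_mats[OF assms] assms
  by (intro tensor_eqI) (auto intro: tensor_of_tensors simp: slice_tensor_of)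

lemma dim_tensor_of [simp]: "dim_row (tensor_of m p M) = m" "dim_col (tensor_of m p M) = p"
  by (simp_all add: tensor_of_def)

text \<open>This resolves the definite description in \<open>tprod\<close>: the right-hand side has
  the required slices, and \<open>tensor_eqI\<close> gives uniqueness.\<close>

lemma tprod_tensor_of:
  assumes "M \<in> bounded_mats m n" "N \<in> bounded_mats n p"
  shows "tprod (tensor_of m n M) (tensor_of n p N) = tensor_of m p (\<lambda>k. M k * N k)"
proof -
  note MN = bounded_mats_mult[OF assms]
  show ?thesis
    unfolding tprod_def dim_tensor_of
    by (rule the_equality)
      (auto simp: slice_tensor_of assms MN intro!: tensor_of_tensors tensor_eqI)
qed

lemma tadjoint_tensor_of:
  assumes "M \<in> bounded_mats m p"
  shows "tadjoint (tensor_of m p M) = tensor_of p m (\<lambda>k. mat_adjoint (M k))"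
proof -
  note aM = bounded_mats_adjoint[OF assms]
  show ?thesis
    unfolding tadjoint_def dim_tensor_of
    by (rule the_equality)
      (auto simp: slice_tensor_of assms aM intro!: tensor_of_tensors tensor_eqI)
qed

lemma tensor_of_one: "tensor_of n n (\<lambda>_. 1\<^sub>m n) = tid n"
proof (rule eq_matI)
  fix i j assume "i < dim_row (tid n)" "j < dim_col (tid n)"
  then show "tensor_of n n (\<lambda>_. 1\<^sub>m n) $$ (i, j) = tid n $$ (i, j)"
    by (auto simp: tensor_of_def tid_def multiplier_const_one multiplier_const_zero)
qed (simp_all add: tid_def)

lemma tunitary_tensor_of:
  assumes "U \<in> bounded_mats n n"
    and "\<And>k. mat_adjoint (U k) * U k = 1\<^sub>m n" "\<And>k. U k * mat_adjoint (U k) = 1\<^sub>m n"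
  shows "tunitary n (tensor_of n n U)"
  unfolding tunitary_def
  using assms bounded_mats_adjoint[OF assms(1)]
  by (simp add: tensor_of_tensors tadjoint_tensor_of tprod_tensor_of tensor_of_one)

theorem quasitubal_svd:
  assumes X: "X \<in> tensors m p" and pos: "m > 0" "p > 0"
  shows "\<exists>U S V. tunitary m U \<and> tunitary p V \<and> S \<in> tensors m p \<and> f_diagonal S \<and>
    (\<forall>i. Suc i < min m p \<longrightarrow> qgeq (S $$ (i, i)) (S $$ (Suc i, Suc i))) \<and>
    qgeq (S $$ (min m p - 1, min m p - 1)) (\<lambda>x. 0) \<and>
    X = tprod (tprod U S) (tadjoint V)"
proof -
  define A where "A = slice X"
  have A: "A \<in> bounded_mats m p" unfolding A_def by (rule slice_bounded_mats[OF X])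
  have dims: "dim_row (A k) = m" "dim_col (A k) = p" for k
    using A by (auto simp: bounded_mats_def)
  \<comment> \<open>The decompositions are chosen independently for each \<open>k\<close>; only
    boundedness in \<open>k\<close> has to be checked afterwards.\<close>
  have "\<forall>k. \<exists>U S V \<sigma>. is_svd (A k) U S V \<sigma>" by (intro allI svd_exists)
  then obtain U S V \<sigma> where svd: "\<And>k. is_svd (A k) (U k) (S k) (V k) (\<sigma> k)"
    unfolding choice_iff by blast
  note svd' = svd[unfolded is_svd_def Let_def dims]
  have U: "U k \<in> carrier_mat m m" and uU: "mat_adjoint (U k) * U k = 1\<^sub>m m" "U k * mat_adjoint (U k) = 1\<^sub>m m"
    and V: "V k \<in> carrier_mat p p" and uV: "mat_adjoint (V k) * V k = 1\<^sub>m p" "V k * mat_adjoint (V k) = 1\<^sub>m p"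
    and S: "S k \<in> carrier_mat m p" and decomp: "A k = U k * S k * mat_adjoint (V k)"
    and diag: "diagonal_mat (S k)" for k
    using svd'[of k] by blast+
  have \<sigma>: "i < min m p \<Longrightarrow> S k $$ (i, i) = of_real (\<sigma> k i)" "i < min m p \<Longrightarrow> 0 \<le> \<sigma> k i"
    "Suc i < min m p \<Longrightarrow> \<sigma> k (Suc i) \<le> \<sigma> k i" for k i
    using svd'[of k] by blast+
  have bU: "U \<in> bounded_mats m m"
    by (rule bounded_mats_norm_le[OF U norm_entry_unitary_le[OF U uU(1)]])
  have bV: "V \<in> bounded_mats p p"
    by (rule bounded_mats_norm_le[OF V norm_entry_unitary_le[OF V uV(1)]])
  \<comment> \<open>Solving for \<open>S k\<close> exhibits it as a product of bounded families, so
    it is bounded as well.\<close>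
  have UAV: "mat_adjoint (U k) * A k * V k = S k" for k
  proof -
    note aU = mat_adjoint_carrier[OF U[of k]] and aV = mat_adjoint_carrier[OF V[of k]]
    note US = mult_carrier_mat[OF U[of k] S[of k]]
    have "mat_adjoint (U k) * A k = mat_adjoint (U k) * (U k * S k) * mat_adjoint (V k)"
      unfolding decomp[of k] by (rule assoc_mult_mat[OF aU US aV, symmetric])
    also have "mat_adjoint (U k) * (U k * S k) = S k"
      unfolding assoc_mult_mat[OF aU U S, symmetric] uU by (rule left_mult_one_mat[OF S])
    finally show ?thesis
      by (simp add: assoc_mult_mat[OF S aV V] uV right_mult_one_mat[OF S])
  qed
  have "(\<lambda>k. mat_adjoint (U k) * A k * V k) \<in> bounded_mats m p"
    by (intro bounded_mats_mult[where n = p] bounded_mats_mult[where n = m] bounded_mats_adjoint A bU bV)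
  then have bS: "S \<in> bounded_mats m p" by (simp add: UAV)
  define T where "T = tensor_of m p S"
  have entry: "T $$ (i, i) = multiplier (\<lambda>k. S k $$ (i, i))" if "i < min m p" for i
    using that by (simp add: T_def tensor_of_def)
  have bounded_entry: "bounded (range (\<lambda>k. S k $$ (i, i)))" if "i < min m p" for i
    using that bS by (simp add: bounded_mats_def)
  show ?thesis
  proof (intro exI conjI allI impI)
    show "tunitary m (tensor_of m m U)" by (rule tunitary_tensor_of[OF bU uU])
    show "tunitary p (tensor_of p p V)" by (rule tunitary_tensor_of[OF bV uV])
    show "T \<in> tensors m p" unfolding T_def by (rule tensor_of_tensors[OF bS])
    show "f_diagonal T" unfolding f_diagonal_def T_def by (simp add: slice_tensor_of bS diag)
    show "qgeq (T $$ (i, i)) (T $$ (Suc i, Suc i))" if i: "Suc i < min m p" for i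
    proof -
      have "i < min m p" using i by simp
      then show ?thesis
        unfolding entry[OF i] entry[OF \<open>i < min m p\<close>] using i
        by (intro qgeq_multiplier[of _ _ "\<lambda>k. \<sigma> k i" "\<lambda>k. \<sigma> k (Suc i)"] bounded_entry \<sigma>)
    qed
    \<comment> \<open>Positivity of \<open>m\<close> and \<open>p\<close> makes this the index of an
      actual last diagonal entry despite truncated subtraction.\<close>
    have last: "min m p - 1 < min m p" using pos by (auto simp: min_def)
    show "qgeq (T $$ (min m p - 1, min m p - 1)) (\<lambda>x. 0)"
      unfolding entry[OF last] multiplier_const_zero[symmetric] using last
      by (intro qgeq_multiplier[of _ _ "\<lambda>k. \<sigma> k (min m p - 1)" "\<lambda>k. 0"] bounded_entry \<sigma>) auto
    have "tprod (tprod (tensor_of m m U) T) (tadjoint (tensor_of p p V))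
        = tensor_of m p (\<lambda>k. U k * S k * mat_adjoint (V k))"
      unfolding T_def tprod_tensor_of[OF bU bS] tadjoint_tensor_of[OF bV]
      by (rule tprod_tensor_of[OF bounded_mats_mult[OF bU bS] bounded_mats_adjoint[OF bV]])
    also have "\<dots> = tensor_of m p A" by (simp only: decomp[symmetric])
    also have "\<dots> = X" unfolding A_def by (rule tensor_of_slice[OF X])
    finally show "X = tprod (tprod (tensor_of m m U) T) (tadjoint (tensor_of p p V))" ..
  qed
qed

end

theorem theorem5p9:
  fixes scale :: "'f::real_or_complex \<Rightarrow> 'h::banach \<Rightarrow> 'h"
    and ip :: "'h \<Rightarrow> 'h \<Rightarrow> 'f"
    and \<phi> :: "int \<Rightarrow> 'h"
    and m p :: nat
    and X :: "('h \<Rightarrow> 'h) mat"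
  assumes "quasitubal scale ip \<phi>"
    and "m > 0" and "p > 0"
    and "X \<in> quasitubal.tensors scale ip \<phi> m p"
  shows "\<exists>U S V.
      quasitubal.tunitary scale ip \<phi> m U \<and>
      quasitubal.tunitary scale ip \<phi> p V \<and>
      S \<in> quasitubal.tensors scale ip \<phi> m p \<and>
      quasitubal.f_diagonal ip \<phi> S \<and>
      (\<forall>i. Suc i < min m p \<longrightarrow>
         quasitubal.qgeq scale ip \<phi> (S $$ (i, i)) (S $$ (Suc i, Suc i))) \<and>
      quasitubal.qgeq scale ip \<phi> (S $$ (min m p - 1, min m p - 1)) (\<lambda>x. 0) \<and>
      X = quasitubal.tprod scale ip \<phi> (quasitubal.tprod scale ip \<phi> U S)
            (quasitubal.tadjoint scale ip \<phi> V)"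
proof -
  interpret quasitubal scale ip \<phi> by (rule assms(1))
  show ?thesis by (rule quasitubal_svd[OF assms(4,2,3)])
qed

end
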